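(* Consider the generalized saddle point problem $$\mathcal M\begin{bmatrix}x\\ y\end{bmatrix}=\begin{bmatrix}A&B^{\mathsf T}\\ B&D\end{bmatrix}\begin{bmatrix}x\\ y\end{bmatrix}=\begin{bmatrix}f\\ \mathbf 0\end{bmatrix}$$ with $B\in\mathcal T^{n\times m}$ Toeplitz, let only $B$ and $f$ be perturbed with $\Delta B\in\mathcal T^{n\times m}$ (so $\Delta A=\mathbf 0$, $\Delta D=\mathbf 0$, $\Delta g=\mathbf 0$), and let $\mathbf L\in\mathbb R^{k\times(m+n)}$. Assume $\mathbf L[x^{\mathsf T},y^{\mathsf T}]^{\mathsf T}\neq\mathbf 0$ (and, for the formula for $\widehat{\mathscr C}$, that all its entries are nonzero). Then the structured normwise, mixed and componentwise condition numbers are $$\widehat{\mathscr K}(\mathbf L[x^{\mathsf T},y^{\mathsf T}]^{\mathsf T})=\frac{\left\|\mathbf L\begin{bmatrix}\mathcal R_{rls}\Phi_{\mathcal T_{nm}}\mathfrak D_{\mathcal T_{nm}}^{-1}&-\begin{bmatrix}M\\ K\end{bmatrix}\end{bmatrix}\right\|_2\left\|\begin{bmatrix}B&f\end{bmatrix}\right\|_F}{\|\mathbf L[x^{\mathsf T},y^{\mathsf T}]^{\mathsf T}\|_2},$$ $$\widehat{\mathscr M}(\mathbf L[x^{\mathsf T},y^{\mathsf T}]^{\mathsf T})=\frac{\left\||\mathbf L\mathcal R_{rls}\Phi_{\mathcal T_{nm}}|\,\mathrm{vec}_{\mathcal T}(|B|)+\left|\mathbf L\begin{bmatrix}M\\ K\end{bmatrix}\right||f|\right\|_\infty}{\|\mathbf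 L[x^{\mathsf T},y^{\mathsf T}]^{\mathsf T}\|_\infty},$$ $$\widehat{\mathscr C}(\mathbf L[x^{\mathsf T},y^{\mathsf T}]^{\mathsf T})=\left\|\mathbf D^\dagger_{\mathbf L[x^{\mathsf T},y^{\mathsf T}]^{\mathsf T}}|\mathbf L\mathcal R_{rls}\Phi_{\mathcal T_{nm}}|\,\mathrm{vec}_{\mathcal T}(|B|)+\mathbf D^\dagger_{\mathbf L[x^{\mathsf T},y^{\mathsf T}]^{\mathsf T}}\left|\mathbf L\begin{bmatrix}M\\ K\end{bmatrix}\right||f|\right\|_\infty .$$
   Context: Notation: $\|\cdot\|_2$ is the Euclidean norm of a vector / spectral norm of a matrix, $\|\cdot\|_\infty$ the infinity norm, $\|\cdot\|_F$ the Frobenius norm. $|X|$ is the entrywise absolute value, and $X\le Y$ for matrices is entrywise. $\mathrm{vec}$ stacks columns, $\otimes$ is the Kronecker product. For a vector $v$, $\mathbf D_v$ is the diagonal matrix with diagonal $v$; $\dagger$ is the Moore-Penrose inverse. Quotients of vectors are entrywise, with $0/0=0$ and $a/0=\infty$ for $a\ne0$. By convention $\|[B\ \ f]\|_F=(\|B\|_F^2+\|f\|_2^2)^{1/2}$, and $|[\Delta B\ \ \Delta f]|\le\eta|[B\ \ f]|$ means $|\Delta B|\le\eta|B|$ and $|\Delta f|\le\eta|f|$. Setting: $A\in\mathbb R^{m\times m}$, $D\in\mathbb R^{n\times n}$, $x,f\in\mathbb R^m$, $y\in\mathbb R^n$; $A$ and $\mathcal M$ are nonsingular. Put $S=D-BA^{-1}B^{\mathsf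 T}$ (nonsingular), $M=A^{-1}+A^{-1}B^{\mathsf T}S^{-1}BA^{-1}$, $N=-A^{-1}B^{\mathsf T}S^{-1}$, $K=-S^{-1}BA^{-1}$, so that $\mathcal M^{-1}=\begin{bmatrix}M&N\\ K&S^{-1}\end{bmatrix}$, and $$\mathcal R_{rls}=\begin{bmatrix}M\otimes y^{\mathsf T}+x^{\mathsf T}\otimes N\\ K\otimes y^{\mathsf T}+x^{\mathsf T}\otimes S^{-1}\end{bmatrix}.$$ Toeplitz structure: $\mathcal T^{n\times m}$ is the space of $n\times m$ real Toeplitz matrices $T=[t_{j-i}]$, with $\mathrm{vec}_{\mathcal T}(T)=[t_{-n+1},\dots,t_0,\dots,t_{m-1}]^{\mathsf T}\in\mathbb R^{m+n-1}$. For $-n+1\le i\le m-1$, $\mathcal J_i$ is the $n\times m$ Toeplitz matrix with $t_i=1$ and all other $t_l=0$; $\Phi_{\mathcal T_{nm}}=[\mathrm{vec}(\mathcal J_{-n+1}),\dots,\mathrm{vec}(\mathcal J_{m-1})]$. $\mathfrak D_{\mathcal T_{nm}}$ is the diagonal matrix with positive diagonal such that $\|T\|_F=\|\mathfrak D_{\mathcal T_{nm}}\mathrm{vec}_{\mathcal T}(T)\|_2$ for all $T\in\mathcal T^{n\times m}$, i.e. its entry for $t_i$ is the square root of the number of positions $(r,s)$ of an $n\times m$ matrix with $s-r=i$. Definitions: for $\Delta B\in\mathcal T^{n\times m}$, $\Delta f\in\mathbb R^m$, let $z=[x^{\mathsf T},y^{\mathsf T}]^{\mathsf T}$ and let $z+\Delta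 z$, $\Delta z=[\Delta x^{\mathsf T},\Delta y^{\mathsf T}]^{\mathsf T}$, be the unique solution (for small perturbations) of $\begin{bmatrix}A&(B+\Delta B)^{\mathsf T}\\ B+\Delta B&D\end{bmatrix}(z+\Delta z)=\begin{bmatrix}f+\Delta f\\ \mathbf 0\end{bmatrix}$. Then $$\widehat{\mathscr K}(\mathbf Lz)=\lim_{\eta\to0}\sup\left\{\frac{\|\mathbf L\Delta z\|_2}{\eta\|\mathbf Lz\|_2}:\|[\Delta B\ \ \Delta f]\|_F\le\eta\|[B\ \ f]\|_F\right\},$$ $$\widehat{\mathscr M}(\mathbf Lz)=\lim_{\eta\to0}\sup\left\{\frac{\|\mathbf L\Delta z\|_\infty}{\eta\|\mathbf Lz\|_\infty}:|[\Delta B\ \ \Delta f]|\le\eta|[B\ \ f]|\right\},$$ $$\widehat{\mathscr C}(\mathbf Lz)=\lim_{\eta\to0}\sup\left\{\frac1\eta\left\|\frac{\mathbf L\Delta z}{\mathbf Lz}\right\|_\infty:|[\Delta B\ \ \Delta f]|\le\eta|[B\ \ f]|\right\},$$ where $\Delta B$ ranges over $\mathcal T^{n\times m}$. *)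

theory Defs
  imports
    "Jordan_Normal_Form.Gauss_Jordan_Elimination"
    "HOL-Library.Extended_Real"
begin

section \<open>Matrix notions\<close>

definition mat_inv :: "real mat \<Rightarrow> real mat" where
  "mat_inv A = the (mat_inverse A)"

lemma mat_inv:
  assumes A: "A \<in> carrier_mat n n" and inv: "invertible_mat A"
  shows "mat_inv A \<in> carrier_mat n n"
    and "A * mat_inv A = 1\<^sub>m n"
    and "mat_inv A * A = 1\<^sub>m n"
proof -
  from inv obtain B where AB: "A * B = 1\<^sub>m n" and BA: "B * A = 1\<^sub>m (dim_row B)"
    using A unfolding invertible_mat_def inverts_mat_def by auto
  have "dim_col B = dim_col (A * B)" by simp
  also have "\<dots> = n" unfolding AB by simp
  finally have cB: "dim_col B = n" .
  have "n = dim_col (B * A)" using A by simp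
  also have "\<dots> = dim_row B" unfolding BA by simp
  finally have B: "B \<in> carrier_mat n n" using cB by auto
  have "A \<in> Units (ring_mat TYPE(real) n ())"
    unfolding Units_def ring_mat_def using A B AB BA by auto
  then obtain C where C: "mat_inverse A = Some C"
    using mat_inverse(1)[OF A, of "()"] by (cases "mat_inverse A") auto
  from mat_inverse(2)[OF A this]
  show "mat_inv A \<in> carrier_mat n n" "A * mat_inv A = 1\<^sub>m n" "mat_inv A * A = 1\<^sub>m n"
    unfolding mat_inv_def C by auto
qed

definition moore_penrose :: "real mat \<Rightarrow> real mat" where
  "moore_penrose A = (THE X. X \<in> carrier_mat (dim_col A) (dim_row A) \<and>
     A * X * A = A \<and> X * A * X = X \<and> (A * X)\<^sup>T = A * X \<and> (X * A)\<^sup>T = X * A)"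

definition diag_of_vec :: "real vec \<Rightarrow> real mat" where
  "diag_of_vec v = mat_diag (dim_vec v) (\<lambda>i. v $ i)"

definition kronecker :: "real mat \<Rightarrow> real mat \<Rightarrow> real mat" (infixl \<open>\<otimes>\<^sub>K\<close> 70) where
  "X \<otimes>\<^sub>K Y = mat (dim_row X * dim_row Y) (dim_col X * dim_col Y)
     (\<lambda>(i, j). X $$ (i div dim_row Y, j div dim_col Y) * Y $$ (i mod dim_row Y, j mod dim_col Y))"

definition row_mat :: "real vec \<Rightarrow> real mat" where
  "row_mat v = mat_of_rows (dim_vec v) [v]"

definition append_cols :: "real mat \<Rightarrow> real mat \<Rightarrow> real mat" (infixr \<open>@\<^sub>c\<close> 65) where
  "A @\<^sub>c B = four_block_mat A B (0\<^sub>m 0 (dim_col A)) (0\<^sub>m 0 (dim_col B))"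

text \<open>Stacks the columns.\<close>

definition vec_of_mat :: "real mat \<Rightarrow> real vec" where
  "vec_of_mat X = vec (dim_row X * dim_col X) (\<lambda>p. X $$ (p mod dim_row X, p div dim_row X))"

section \<open>Norms\<close>

definition norm2 :: "real vec \<Rightarrow> real" where
  "norm2 v = sqrt (\<Sum>i<dim_vec v. (v $ i)\<^sup>2)"

text \<open>Polymorphic because it is also applied to vectors of extended reals.
  Only meaningful for vectors of positive dimension.\<close>

definition norm_inf :: "'a::{abs, linorder} vec \<Rightarrow> 'a" where
  "norm_inf v = Max ((\<lambda>i. \<bar>v $ i\<bar>) ` {..<dim_vec v})"

definition spectral_norm :: "real mat \<Rightarrow> real" where
  "spectral_norm X = Sup {norm2 (X *\<^sub>v v) | v. v \<in> carrier_vec (dim_col X) \<and> norm2 v \<le> 1}"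

definition frob_norm :: "real mat \<Rightarrow> real" where
  "frob_norm X = sqrt (\<Sum>i<dim_row X. \<Sum>j<dim_col X. (X $$ (i, j))\<^sup>2)"

definition frob_norm_pair :: "real mat \<Rightarrow> real vec \<Rightarrow> real" where
  "frob_norm_pair X v = sqrt ((frob_norm X)\<^sup>2 + (norm2 v)\<^sup>2)"

abbreviation abs_mat :: "real mat \<Rightarrow> real mat" where
  "abs_mat \<equiv> map_mat abs"

abbreviation abs_vec :: "real vec \<Rightarrow> real vec" where
  "abs_vec \<equiv> map_vec abs"

definition quot_vec :: "real vec \<Rightarrow> real vec \<Rightarrow> ereal vec" where
  "quot_vec u v = vec (dim_vec v)
     (\<lambda>i. if v $ i = 0 then (if u $ i = 0 then 0 else \<infinity>) else ereal (u $ i / v $ i))"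

section \<open>Toeplitz matrices\<close>

definition toeplitz_mats :: "nat \<Rightarrow> nat \<Rightarrow> real mat set" where
  "toeplitz_mats n m = {T \<in> carrier_mat n m.
     \<exists>t :: int \<Rightarrow> real. \<forall>r<n. \<forall>s<m. T $$ (r, s) = t (int s - int r)}"

text \<open>The parameters \<open>t\<^sub>l\<close>, \<open>-n+1 \<le> l \<le> m-1\<close>, of an \<open>n \<times> m\<close> Toeplitz matrix (with
  \<open>n, m > 0\<close>) are numbered by \<open>p = l + (n - 1) \<in> {0..<m+n-1}\<close>. They are read off the
  first column (\<open>l \<le> 0\<close>) and the first row (\<open>l \<ge> 0\<close>).\<close>

definition vec_toep :: "real mat \<Rightarrow> real vec" where
  "vec_toep T = (let n = dim_row T; m = dim_col T in
     vec (m + n - 1) (\<lambda>p. if p < n - 1 then T $$ (n - 1 - p, 0) else T $$ (0, p - (n - 1))))"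

definition toep_positions :: "nat \<Rightarrow> nat \<Rightarrow> nat \<Rightarrow> (nat \<times> nat) set" where
  "toep_positions n m p = {(r, s). r < n \<and> s < m \<and> int s - int r = int p - (int n - 1)}"

definition toep_basis :: "nat \<Rightarrow> nat \<Rightarrow> nat \<Rightarrow> real mat" where
  "toep_basis n m p = mat n m (\<lambda>(r, s). if (r, s) \<in> toep_positions n m p then 1 else 0)"

definition toep_Phi :: "nat \<Rightarrow> nat \<Rightarrow> real mat" where
  "toep_Phi n m = mat_of_cols (n * m) (map (\<lambda>p. vec_of_mat (toep_basis n m p)) [0..<m + n - 1])"

definition toep_D :: "nat \<Rightarrow> nat \<Rightarrow> real mat" where
  "toep_D n m = mat_diag (m + n - 1) (\<lambda>p. sqrt (real (card (toep_positions n m p))))"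

text \<open>\<open>toep_D n m\<close> is the diagonal scaling that turns the Frobenius norm of a Toeplitz matrix
  into the Euclidean norm of its parameter vector.\<close>

lemma frob_norm_toeplitz:
  assumes "0 < n" "0 < m" and T: "T \<in> toeplitz_mats n m"
  shows "frob_norm T = norm2 (toep_D n m *\<^sub>v vec_toep T)"
proof -
  from T obtain t :: "int \<Rightarrow> real" where dims: "dim_row T = n" "dim_col T = m"
    and t: "\<And>r s. r < n \<Longrightarrow> s < m \<Longrightarrow> T $$ (r, s) = t (int s - int r)"
    unfolding toeplitz_mats_def by auto
  define u where "u p = t (int p - (int n - 1))" for p
  define g where "g = (\<lambda>(r::nat, s::nat). s + (n - 1) - r)"
  have pos: "toep_positions n m p = {q \<in> {..<n} \<times> {..<m}. g q = p}" for p
    unfolding toep_positions_def g_def by auto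
  have vt: "vec_toep T $ p = u p" if "p < m + n - 1" for p
    using that assms(1,2) t[of "n - 1 - p" 0] t[of 0 "p - (n - 1)"]
    unfolding vec_toep_def u_def by (auto simp: dims Let_def algebra_simps of_nat_diff)
  have "(\<Sum>i<n. \<Sum>j<m. (T $$ (i, j))\<^sup>2) = (\<Sum>q\<in>{..<n} \<times> {..<m}. (T $$ q)\<^sup>2)"
    by (subst sum.cartesian_product) (simp add: case_prod_beta)
  also have "\<dots> = (\<Sum>q\<in>{..<n} \<times> {..<m}. (u (g q))\<^sup>2)"
  proof (rule sum.cong[OF refl])
    fix q assume "q \<in> {..<n} \<times> {..<m}"
    then obtain r s where q: "q = (r, s)" "r < n" "s < m" by auto
    then have "int (s + (n - 1) - r) - (int n - 1) = int s - int r" by linarith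
    with q t[of r s] show "(T $$ q)\<^sup>2 = (u (g q))\<^sup>2"
      by (simp add: u_def g_def)
  qed
  also have "\<dots> = (\<Sum>p<m + n - 1. \<Sum>q\<in>{q \<in> {..<n} \<times> {..<m}. g q = p}. (u (g q))\<^sup>2)"
    by (subst sum.group) (auto simp: g_def)
  also have "\<dots> = (\<Sum>p<m + n - 1. real (card (toep_positions n m p)) * (u p)\<^sup>2)"
    by (rule sum.cong[OF refl]) (simp add: pos)
  also have "\<dots> = (\<Sum>p<m + n - 1. ((toep_D n m *\<^sub>v vec_toep T) $ p)\<^sup>2)"
  proof (rule sum.cong[OF refl])
    fix p assume "p \<in> {..<m + n - 1}"
    then have p: "p < m + n - 1" by simp
    have d: "dim_vec (vec_toep T) = m + n - 1" by (simp add: vec_toep_def dims Let_def)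
    have "(toep_D n m *\<^sub>v vec_toep T) $ p = sqrt (real (card (toep_positions n m p))) * u p"
      using p d vt[OF p] unfolding toep_D_def mat_diag_def
      by (simp add: scalar_prod_def if_distrib[of "\<lambda>c. c * _"] cong: if_cong)
    then show "real (card (toep_positions n m p)) * (u p)\<^sup>2 = ((toep_D n m *\<^sub>v vec_toep T) $ p)\<^sup>2"
      by (simp add: power_mult_distrib)
  qed
  finally show ?thesis
    by (simp add: frob_norm_def norm2_def dims toep_D_def mat_diag_def)
qed

section \<open>Perturbed saddle point systems and condition numbers\<close>

definition saddle_mat :: "real mat \<Rightarrow> real mat \<Rightarrow> real mat \<Rightarrow> real mat" where
  "saddle_mat A B D = four_block_mat A (B\<^sup>T) B D"

text \<open>All changes \<open>\<Delta>z\<close> of the solution \<open>z\<close> caused by Toeplitz perturbations \<open>\<Delta>B\<close> of \<open>B\<close> and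
  perturbations \<open>\<Delta>f\<close> of \<open>f\<close> that are admissible in the sense of \<open>P\<close>. When the saddle point
  matrix is nonsingular, \<open>\<Delta>z\<close> is uniquely determined by small \<open>\<Delta>B\<close> and \<open>\<Delta>f\<close>; large
  perturbations, for which this may fail, are irrelevant in the limits below.\<close>

definition solution_changes ::
  "real mat \<Rightarrow> real mat \<Rightarrow> real mat \<Rightarrow> real vec \<Rightarrow> real vec \<Rightarrow>
   (real mat \<Rightarrow> real vec \<Rightarrow> bool) \<Rightarrow> real vec set" where
  "solution_changes A B D f z P = {\<Delta>z \<in> carrier_vec (dim_vec z).
     \<exists>\<Delta>B \<in> toeplitz_mats (dim_row B) (dim_col B). \<exists>\<Delta>f \<in> carrier_vec (dim_vec f).
       P \<Delta>B \<Delta>f \<and>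
       saddle_mat A (B + \<Delta>B) D *\<^sub>v (z + \<Delta>z) = (f + \<Delta>f) @\<^sub>v 0\<^sub>v (dim_row B)}"

definition normwise_admissible ::
  "real mat \<Rightarrow> real vec \<Rightarrow> real \<Rightarrow> real mat \<Rightarrow> real vec \<Rightarrow> bool" where
  "normwise_admissible B f \<eta> \<Delta>B \<Delta>f \<longleftrightarrow> frob_norm_pair \<Delta>B \<Delta>f \<le> \<eta> * frob_norm_pair B f"

definition entrywise_admissible ::
  "real mat \<Rightarrow> real vec \<Rightarrow> real \<Rightarrow> real mat \<Rightarrow> real vec \<Rightarrow> bool" where
  "entrywise_admissible B f \<eta> \<Delta>B \<Delta>f \<longleftrightarrow>
     abs_mat \<Delta>B \<le> \<eta> \<cdot>\<^sub>m abs_mat B \<and> abs_vec \<Delta>f \<le> \<eta> \<cdot>\<^sub>v abs_vec f"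

text \<open>The suprema are taken in the extended reals, as they may be infinite unless \<open>\<eta>\<close> is
  small.\<close>

definition normwise_sup ::
  "real mat \<Rightarrow> real mat \<Rightarrow> real mat \<Rightarrow> real vec \<Rightarrow> real mat \<Rightarrow> real vec \<Rightarrow> real \<Rightarrow> ereal" where
  "normwise_sup A B D f L z \<eta> =
     (SUP \<Delta>z \<in> solution_changes A B D f z (normwise_admissible B f \<eta>).
        ereal (norm2 (L *\<^sub>v \<Delta>z) / (\<eta> * norm2 (L *\<^sub>v z))))"

definition mixed_sup ::
  "real mat \<Rightarrow> real mat \<Rightarrow> real mat \<Rightarrow> real vec \<Rightarrow> real mat \<Rightarrow> real vec \<Rightarrow> real \<Rightarrow> ereal" where
  "mixed_sup A B D f L z \<eta> =
     (SUP \<Delta>z \<in> solution_changes A B D f z (entrywise_admissible B f \<eta>).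
        ereal (norm_inf (L *\<^sub>v \<Delta>z) / (\<eta> * norm_inf (L *\<^sub>v z))))"

definition componentwise_sup ::
  "real mat \<Rightarrow> real mat \<Rightarrow> real mat \<Rightarrow> real vec \<Rightarrow> real mat \<Rightarrow> real vec \<Rightarrow> real \<Rightarrow> ereal" where
  "componentwise_sup A B D f L z \<eta> =
     (SUP \<Delta>z \<in> solution_changes A B D f z (entrywise_admissible B f \<eta>).
        ereal (1 / \<eta>) * norm_inf (quot_vec (L *\<^sub>v \<Delta>z) (L *\<^sub>v z)))"

definition normwise_cond ::
  "real mat \<Rightarrow> real mat \<Rightarrow> real mat \<Rightarrow> real vec \<Rightarrow> real mat \<Rightarrow> real vec \<Rightarrow> ereal" where
  "normwise_cond A B D f L z = Lim (at_right 0) (normwise_sup A B D f L z)"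

definition mixed_cond ::
  "real mat \<Rightarrow> real mat \<Rightarrow> real mat \<Rightarrow> real vec \<Rightarrow> real mat \<Rightarrow> real vec \<Rightarrow> ereal" where
  "mixed_cond A B D f L z = Lim (at_right 0) (mixed_sup A B D f L z)"

definition componentwise_cond ::
  "real mat \<Rightarrow> real mat \<Rightarrow> real mat \<Rightarrow> real vec \<Rightarrow> real mat \<Rightarrow> real vec \<Rightarrow> ereal" where
  "componentwise_cond A B D f L z = Lim (at_right 0) (componentwise_sup A B D f L z)"

end

theory Submission
  imports
    Defs
    "Jordan_Normal_Form.Determinant"
    "HOL-Analysis.L2_Norm"
begin

text \<open>Write \<open>P\<close> for the saddle point matrix, \<open>Q\<close> for its inverse, and \<open>E\<close>, \<open>h\<close> for the changes
  of the matrix and of the right-hand side that are induced by \<open>\<Delta>B\<close> and \<open>\<Delta>f\<close>. The perturbed system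
  is equivalent to \<open>\<Delta>z = Q (h - E z) - Q E \<Delta>z\<close>. If \<open>E\<close> and \<open>h\<close> are of order \<open>\<eta>\<close>, then so is \<open>\<Delta>z\<close>,
  and the last term is of order \<open>\<eta>\<^sup>2\<close>; moreover \<open>P + E\<close> is nonsingular for small \<open>\<eta>\<close>, so that every
  small perturbation does produce a \<open>\<Delta>z\<close>. Hence, for each of the three measures of \<open>L \<Delta>z\<close>, the
  supremum of the measure divided by \<open>\<eta>\<close> tends to the least upper bound of the measure of the linear part
  \<open>L Q (h - E z)\<close> over the admissible perturbations with \<open>\<eta> = 1\<close>. This is \<open>first_order_limit\<close>; it
  only uses that the measure is positively homogeneous and Lipschitz.

  By the Schur complement, \<open>Q\<close> has the blocks \<open>M\<close>, \<open>N\<close>, \<open>K\<close>, \<open>S\<^sup>-\<^sup>1\<close> (\<open>saddle_mat_inverse\<close>), and with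
  the parameter vector \<open>t\<close> of \<open>\<Delta>B\<close> the linear part becomes \<open>L [M; K] \<Delta>f - L R \<Phi> t\<close>
  (\<open>linear_part\<close>). It remains to maximise this. In the normwise case the scaling \<open>toep_D\<close> turns the
  constraint into a Euclidean ball in \<open>(toep_D t, \<Delta>f)\<close>, which gives a spectral norm
  (\<open>normwise_limit\<close>). In the other two cases the constraint is a box, and each entry of the linear
  part attains its maximum at a suitable choice of signs (\<open>entrywise_limit\<close>); the two cases
  differ only in the weights of the maximum norm.\<close>

section \<open>The sum norm of vectors and the entry sum of matrices\<close>

text \<open>The sum norm of a vector and the sum of the absolute values of all entries of a matrix serve for
  error estimates only. The entry sum is not the operator norm induced by \<open>norm1\<close>, but an upper bound
  of it, which suffices.\<close>

definition norm1 :: "real vec \<Rightarrow> real" where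
  "norm1 v = (\<Sum>i<dim_vec v. \<bar>v $ i\<bar>)"

definition entry_sum :: "real mat \<Rightarrow> real" where
  "entry_sum X = (\<Sum>i<dim_row X. \<Sum>j<dim_col X. \<bar>X $$ (i, j)\<bar>)"

lemma norm1_nonneg [simp]: "0 \<le> norm1 v"
  by (simp add: norm1_def sum_nonneg)

lemma entry_sum_nonneg [simp]: "0 \<le> entry_sum X"
  by (simp add: entry_sum_def sum_nonneg)

lemma norm1_entry_le: "i < dim_vec v \<Longrightarrow> \<bar>v $ i\<bar> \<le> norm1 v"
  unfolding norm1_def by (rule member_le_sum) auto

lemma norm1_minus_le:
  assumes "u \<in> carrier_vec n" "v \<in> carrier_vec n"
  shows "norm1 (u - v) \<le> norm1 u + norm1 v"
proof -
  have "norm1 (u - v) = (\<Sum>i<n. \<bar>u $ i - v $ i\<bar>)"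
    using assms by (simp add: norm1_def)
  also have "\<dots> \<le> (\<Sum>i<n. \<bar>u $ i\<bar> + \<bar>v $ i\<bar>)"
    by (intro sum_mono abs_triangle_ineq4)
  finally show ?thesis using assms by (simp add: norm1_def sum.distrib)
qed

lemma norm1_smult: "norm1 (c \<cdot>\<^sub>v v) = \<bar>c\<bar> * norm1 v"
  by (simp add: norm1_def abs_mult sum_distrib_left)

lemma norm1_uminus: "norm1 (- v) = norm1 v"
  by (simp add: norm1_def)

lemma norm1_eq_0: "v \<in> carrier_vec n \<Longrightarrow> norm1 v = 0 \<Longrightarrow> v = 0\<^sub>v n"
  by (intro eq_vecI) (auto simp: norm1_def sum_nonneg_eq_0_iff)

lemma norm1_append:
  "norm1 (u @\<^sub>v v) = norm1 u + norm1 v"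
proof -
  have "norm1 (u @\<^sub>v v) = (\<Sum>i\<in>{..<dim_vec u} \<union> {dim_vec u..<dim_vec u + dim_vec v}. \<bar>(u @\<^sub>v v) $ i\<bar>)"
    unfolding norm1_def by (rule sum.cong) auto
  also have "\<dots> = (\<Sum>i<dim_vec u. \<bar>(u @\<^sub>v v) $ i\<bar>) + (\<Sum>i=dim_vec u..<dim_vec u + dim_vec v. \<bar>(u @\<^sub>v v) $ i\<bar>)"
    by (rule sum.union_disjoint) auto
  also have "(\<Sum>i=dim_vec u..<dim_vec u + dim_vec v. \<bar>(u @\<^sub>v v) $ i\<bar>) = norm1 v"
    unfolding norm1_def
    by (rule sum.reindex_bij_witness[of _ "\<lambda>i. i + dim_vec u" "\<lambda>i. i - dim_vec u"]) auto
  finally show ?thesis by (simp add: norm1_def)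
qed

lemma norm1_mult_le:
  assumes "dim_vec v = dim_col X"
  shows "norm1 (X *\<^sub>v v) \<le> entry_sum X * norm1 v"
proof -
  have "norm1 (X *\<^sub>v v) = (\<Sum>i<dim_row X. \<bar>\<Sum>j<dim_col X. X $$ (i, j) * v $ j\<bar>)"
    using assms by (simp add: norm1_def scalar_prod_def lessThan_atLeast0)
  also have "\<dots> \<le> (\<Sum>i<dim_row X. \<Sum>j<dim_col X. \<bar>X $$ (i, j)\<bar> * norm1 v)"
  proof (rule sum_mono)
    fix i
    have "\<bar>\<Sum>j<dim_col X. X $$ (i, j) * v $ j\<bar> \<le> (\<Sum>j<dim_col X. \<bar>X $$ (i, j) * v $ j\<bar>)"
      by (rule sum_abs)
    also have "\<dots> \<le> (\<Sum>j<dim_col X. \<bar>X $$ (i, j)\<bar> * norm1 v)"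
      using assms by (intro sum_mono) (auto simp: abs_mult intro!: mult_left_mono norm1_entry_le)
    finally show "\<bar>\<Sum>j<dim_col X. X $$ (i, j) * v $ j\<bar> \<le> (\<Sum>j<dim_col X. \<bar>X $$ (i, j)\<bar> * norm1 v)" .
  qed
  finally show ?thesis by (simp add: entry_sum_def sum_distrib_right)
qed

lemma entry_sum_smult: "entry_sum (c \<cdot>\<^sub>m X) = \<bar>c\<bar> * entry_sum X"
  by (simp add: entry_sum_def abs_mult sum_distrib_left)

lemma entry_sum_le:
  assumes "\<And>i j. i < dim_row X \<Longrightarrow> j < dim_col X \<Longrightarrow> \<bar>X $$ (i, j)\<bar> \<le> c"
  shows "entry_sum X \<le> real (dim_row X) * (real (dim_col X) * c)"
proof -
  have "entry_sum X \<le> (\<Sum>i<dim_row X. \<Sum>j<dim_col X. c)"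
    unfolding entry_sum_def by (intro sum_mono assms) auto
  then show ?thesis by simp
qed

lemma invertible_matI:
  fixes X :: "real mat"
  assumes X: "X \<in> carrier_mat n n"
    and inj: "\<And>v. v \<in> carrier_vec n \<Longrightarrow> X *\<^sub>v v = 0\<^sub>v n \<Longrightarrow> v = 0\<^sub>v n"
  shows "invertible_mat X"
proof -
  have "det X \<noteq> 0" using det_0_iff_vec_prod_zero_field[OF X] inj by blast
  from det_non_zero_imp_unit[OF X this, of "()"] obtain Y
    where "Y \<in> carrier_mat n n" "X * Y = 1\<^sub>m n" "Y * X = 1\<^sub>m n"
    unfolding Units_def ring_mat_def by auto
  with X show ?thesis unfolding invertible_mat_def inverts_mat_def
    by (metis carrier_matD square_mat.simps)
qed

section \<open>First-order perturbation of linear systems\<close>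

text \<open>The equation for the solution change, with its part of second order separated.\<close>

lemma perturbed_solution:
  fixes P Q E :: "real mat" and z w b h :: "real vec"
  assumes P: "P \<in> carrier_mat N N" and Q: "Q \<in> carrier_mat N N" and QP: "Q * P = 1\<^sub>m N"
    and E: "E \<in> carrier_mat N N"
    and [simp]: "z \<in> carrier_vec N" "w \<in> carrier_vec N" "b \<in> carrier_vec N" "h \<in> carrier_vec N"
    and b: "P *\<^sub>v z = b" and eq: "(P + E) *\<^sub>v (z + w) = b + h"
  shows "w = Q *\<^sub>v (h - E *\<^sub>v z) - Q *\<^sub>v (E *\<^sub>v w)"
proof -
  note [simp] = mult_mat_vec_carrier[OF P] mult_mat_vec_carrier[OF E] mult_mat_vec_carrier[OF Q]
  have "b + P *\<^sub>v w + (E *\<^sub>v z + E *\<^sub>v w) = b + h"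
    using eq P E by (simp add: add_mult_distrib_mat_vec[OF P E] mult_add_distrib_mat_vec[OF P]
        mult_add_distrib_mat_vec[OF E] b)
  then have "P *\<^sub>v w = (h - E *\<^sub>v z) - E *\<^sub>v w"
    using P E assms(5-8) by (auto simp: vec_eq_iff)
  then have "Q *\<^sub>v (P *\<^sub>v w) = Q *\<^sub>v ((h - E *\<^sub>v z) - E *\<^sub>v w)" by simp
  then show ?thesis
    using P Q QP by (simp flip: assoc_mult_mat_vec[OF Q P]
        add: mult_minus_distrib_mat_vec[OF Q])
qed

lemma perturbed_solution_exists:
  fixes P Q E :: "real mat" and z b h :: "real vec"
  assumes P: "P \<in> carrier_mat N N" and Q: "Q \<in> carrier_mat N N" and QP: "Q * P = 1\<^sub>m N"
    and E: "E \<in> carrier_mat N N" and small: "entry_sum Q * entry_sum E < 1"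
    and z: "z \<in> carrier_vec N" and r: "r \<in> carrier_vec N"
  shows "\<exists>w \<in> carrier_vec N. (P + E) *\<^sub>v (z + w) = r"
proof -
  have PE: "P + E \<in> carrier_mat N N" using E by simp
  have "v = 0\<^sub>v N" if v: "v \<in> carrier_vec N" and 0: "(P + E) *\<^sub>v v = 0\<^sub>v N" for v
  proof -
    have "v = Q *\<^sub>v (0\<^sub>v N - E *\<^sub>v 0\<^sub>v N) - Q *\<^sub>v (E *\<^sub>v v)"
      by (rule perturbed_solution[OF P Q QP E, where b = "0\<^sub>v N"]) (use v 0 P in auto)
    also have "0\<^sub>v N - E *\<^sub>v 0\<^sub>v N = 0\<^sub>v N"
      using E by (intro eq_vecI) auto
    also have "Q *\<^sub>v 0\<^sub>v N - Q *\<^sub>v (E *\<^sub>v v) = - (Q *\<^sub>v (E *\<^sub>v v))"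
      using E Q by (intro eq_vecI) auto
    finally have "norm1 v = norm1 (Q *\<^sub>v (E *\<^sub>v v))"
      using norm1_uminus by metis
    also have "\<dots> \<le> entry_sum Q * norm1 (E *\<^sub>v v)"
      using v E Q by (intro norm1_mult_le) auto
    also have "\<dots> \<le> entry_sum Q * (entry_sum E * norm1 v)"
      using v E by (intro mult_left_mono norm1_mult_le) auto
    finally have "(1 - entry_sum Q * entry_sum E) * norm1 v \<le> 0" by (simp add: algebra_simps)
    then have "norm1 v \<le> 0" using small by (simp add: mult_le_0_iff)
    then show ?thesis using norm1_eq_0[OF v] norm1_nonneg[of v] by linarith
  qed
  then have inv: "invertible_mat (P + E)" by (rule invertible_matI[OF PE])
  define w where "w = mat_inv (P + E) *\<^sub>v r - z"
  have c: "mat_inv (P + E) *\<^sub>v r \<in> carrier_vec N" using mat_inv(1)[OF PE inv] r by auto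
  have "z + w = mat_inv (P + E) *\<^sub>v r"
    unfolding w_def using z c carrier_vecD[OF c] by (intro eq_vecI) (auto simp del: dim_mult_mat_vec index_mult_mat_vec)
  then have "(P + E) *\<^sub>v (z + w) = r"
    using assoc_mult_mat_vec[OF PE mat_inv(1)[OF PE inv] r] mat_inv(2)[OF PE inv] r by simp
  moreover have "w \<in> carrier_vec N" using z c by (auto simp: w_def)
  ultimately show ?thesis by blast
qed

text \<open>\<open>U\<close> is the set of perturbations \<open>(E, h)\<close> at scale 1, and \<open>W \<eta>\<close> the set of solution changes
  caused by the perturbations \<open>(\<eta> E, \<eta> h)\<close>. The measure \<open>F\<close> of a vector is positively homogeneous and
  Lipschitz, and \<open>\<sigma>\<close> is the least upper bound of \<open>F\<close> on the linear parts. Neither compactness of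
  \<open>U\<close> nor attainment of \<open>\<sigma>\<close> is required.\<close>

lemma first_order_limit:
  fixes F :: "real vec \<Rightarrow> real" and P Q L :: "real mat" and z b :: "real vec"
    and U :: "(real mat \<times> real vec) set" and W :: "real \<Rightarrow> real vec set"
  defines "lin \<equiv> \<lambda>E h. L *\<^sub>v (Q *\<^sub>v (h - E *\<^sub>v z))"
  assumes P: "P \<in> carrier_mat N N" and Q: "Q \<in> carrier_mat N N" and QP: "Q * P = 1\<^sub>m N"
    and L: "L \<in> carrier_mat k N"
    and z: "z \<in> carrier_vec N" and b: "b \<in> carrier_vec N" and Pz: "P *\<^sub>v z = b"
    and U: "\<And>E h. (E, h) \<in> U \<Longrightarrow> E \<in> carrier_mat N N \<and> h \<in> carrier_vec N \<and>
              entry_sum E \<le> c \<and> norm1 h \<le> c"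
    and ne: "U \<noteq> {}"
    and C: "0 \<le> C"
    and F_add: "\<And>u v. u \<in> carrier_vec k \<Longrightarrow> v \<in> carrier_vec k \<Longrightarrow> F (u + v) \<le> F u + C * norm1 v"
    and F_scale: "\<And>\<eta> u. 0 < \<eta> \<Longrightarrow> u \<in> carrier_vec k \<Longrightarrow> F (\<eta> \<cdot>\<^sub>v u) = \<eta> * F u"
    and ub: "\<And>E h. (E, h) \<in> U \<Longrightarrow> F (lin E h) \<le> \<sigma>"
    and lub: "\<And>\<tau>. (\<And>E h. (E, h) \<in> U \<Longrightarrow> F (lin E h) \<le> \<tau>) \<Longrightarrow> \<sigma> \<le> \<tau>"
    and W: "\<And>\<eta>. 0 < \<eta> \<Longrightarrow> W \<eta> = {w \<in> carrier_vec N. \<exists>(E, h) \<in> U.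
              (P + \<eta> \<cdot>\<^sub>m E) *\<^sub>v (z + w) = b + \<eta> \<cdot>\<^sub>v h}"
  shows "((\<lambda>\<eta>. SUP w \<in> W \<eta>. ereal (F (L *\<^sub>v w) / \<eta>)) \<longlongrightarrow> ereal \<sigma>) (at_right 0)"
proof -
  define q where "q = entry_sum Q"
  define d where "d = c + c * norm1 z"
  define G where "G = C * (entry_sum L * (q * (c * (2 * (q * d)))))"
  obtain E\<^sub>0 h\<^sub>0 where U0: "(E\<^sub>0, h\<^sub>0) \<in> U" using ne by auto
  have c: "0 \<le> c" using U[OF U0] entry_sum_nonneg[of E\<^sub>0] by linarith
  have q: "0 \<le> q" by (simp add: q_def)
  have d: "0 \<le> d" using c by (simp add: d_def)
  define \<eta>\<^sub>0 where "\<eta>\<^sub>0 = 1 / (2 * (q * c + 1))"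
  have qc: "0 \<le> q * c" using q c by simp
  have \<eta>\<^sub>0: "0 < \<eta>\<^sub>0" using qc by (simp add: \<eta>\<^sub>0_def)
  have lin_carr: "lin E h \<in> carrier_vec k" if "(E, h) \<in> U" for E h
    by (rule carrier_vecI) (use L in \<open>simp add: lin_def\<close>)
  have half: "\<eta> * (q * c) \<le> 1 / 2" if "0 < \<eta>" "\<eta> < \<eta>\<^sub>0" for \<eta>
  proof -
    have "\<eta> * (q * c) \<le> \<eta>\<^sub>0 * (q * c + 1)"
      using that qc by (intro mult_mono) auto
    also have "\<dots> = 1 / 2" using qc by (simp add: \<eta>\<^sub>0_def field_simps)
    finally show ?thesis .
  qed
  \<comment> \<open>The second-order term, divided by \<open>\<eta>\<close>, changes \<open>F\<close> by at most \<open>G * \<eta>\<close>.\<close>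
  have rem: "F (L *\<^sub>v w) / \<eta> \<le> F (lin E h) + G * \<eta> \<and> F (lin E h) \<le> F (L *\<^sub>v w) / \<eta> + G * \<eta>"
    if \<eta>: "0 < \<eta>" "\<eta> < \<eta>\<^sub>0" and Eh: "(E, h) \<in> U" and w: "w \<in> carrier_vec N"
      and eq: "(P + \<eta> \<cdot>\<^sub>m E) *\<^sub>v (z + w) = b + \<eta> \<cdot>\<^sub>v h" for \<eta> w E h
  proof -
    have E: "E \<in> carrier_mat N N" and h: "h \<in> carrier_vec N" and bE: "entry_sum E \<le> c"
      and bh: "norm1 h \<le> c" using U[OF Eh] by auto
    have Ez: "E *\<^sub>v z \<in> carrier_vec N" and Ew: "E *\<^sub>v w \<in> carrier_vec N" using E z w by auto
    define r where "r = h - E *\<^sub>v z"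
    have r: "r \<in> carrier_vec N" using h Ez by (simp add: r_def)
    have Qr: "Q *\<^sub>v r \<in> carrier_vec N" and QEw: "Q *\<^sub>v (E *\<^sub>v w) \<in> carrier_vec N" using Q r Ew by auto
    have "w = Q *\<^sub>v (\<eta> \<cdot>\<^sub>v h - (\<eta> \<cdot>\<^sub>m E) *\<^sub>v z) - Q *\<^sub>v ((\<eta> \<cdot>\<^sub>m E) *\<^sub>v w)"
      by (rule perturbed_solution[OF P Q QP _ z w b _ Pz eq]) (use E h in auto)
    also have "\<eta> \<cdot>\<^sub>v h - (\<eta> \<cdot>\<^sub>m E) *\<^sub>v z = \<eta> \<cdot>\<^sub>v r"
      unfolding r_def using E h z by (intro eq_vecI) (auto simp: algebra_simps)
    also have "(\<eta> \<cdot>\<^sub>m E) *\<^sub>v w = \<eta> \<cdot>\<^sub>v (E *\<^sub>v w)"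
      using E w by (intro eq_vecI) auto
    finally have w_eq: "w = \<eta> \<cdot>\<^sub>v (Q *\<^sub>v r - Q *\<^sub>v (E *\<^sub>v w))"
      unfolding mult_mat_vec[OF Q r] mult_mat_vec[OF Q Ew]
      using Qr QEw by (auto simp: vec_eq_iff algebra_simps)
    have nEw: "norm1 (E *\<^sub>v w) \<le> c * norm1 w"
      using norm1_mult_le[of w E] E w mult_right_mono[OF bE norm1_nonneg[of w]] by auto
    have nr: "norm1 r \<le> d"
    proof -
      have "norm1 r \<le> norm1 h + norm1 (E *\<^sub>v z)" unfolding r_def by (rule norm1_minus_le[OF h Ez])
      also have "norm1 (E *\<^sub>v z) \<le> c * norm1 z"
        using norm1_mult_le[of z E] E z mult_right_mono[OF bE norm1_nonneg[of z]] by auto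
      finally show ?thesis using bh by (simp add: d_def)
    qed
    have nQEw: "norm1 (Q *\<^sub>v (E *\<^sub>v w)) \<le> q * (c * norm1 w)"
      using norm1_mult_le[of "E *\<^sub>v w" Q] Q carrier_vecD[OF Ew] mult_left_mono[OF nEw q] by (auto simp: q_def)
    have nQr: "norm1 (Q *\<^sub>v r) \<le> q * d"
      using norm1_mult_le[of r Q] Q carrier_vecD[OF r] mult_left_mono[OF nr q] by (auto simp: q_def)
    have "norm1 w = \<eta> * norm1 (Q *\<^sub>v r - Q *\<^sub>v (E *\<^sub>v w))"
      using \<eta> by (subst w_eq) (simp add: norm1_smult)
    also have "\<dots> \<le> \<eta> * (q * d + q * (c * norm1 w))"
      using norm1_minus_le[OF Qr QEw] nQEw nQr \<eta> by (intro mult_left_mono) auto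
    also have "\<dots> = \<eta> * (q * d) + (\<eta> * (q * c)) * norm1 w" by (simp add: algebra_simps)
    also have "\<dots> \<le> \<eta> * (q * d) + (1 / 2) * norm1 w"
      using half[OF \<eta>] by (intro add_left_mono mult_right_mono) auto
    \<comment> \<open>The coefficient of \<open>norm1 w\<close> on the right is \<open>1 / 2\<close>; absorbing that term gives a bound of order \<open>\<eta>\<close> on \<open>w\<close>.\<close>
    finally have nw: "norm1 w \<le> 2 * (q * d) * \<eta>" by (simp add: algebra_simps)
    define e where "e = L *\<^sub>v (Q *\<^sub>v (E *\<^sub>v w))"
    have e: "e \<in> carrier_vec k" by (rule carrier_vecI) (use L in \<open>simp add: e_def\<close>)
    have ell: "lin E h \<in> carrier_vec k" by (rule lin_carr[OF Eh])
    have ne: "C * norm1 e \<le> G * \<eta>"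
    proof -
      have "norm1 e \<le> entry_sum L * norm1 (Q *\<^sub>v (E *\<^sub>v w))"
        unfolding e_def by (rule norm1_mult_le) (use L Q in auto)
      also have "\<dots> \<le> entry_sum L * (q * (c * (2 * (q * d) * \<eta>)))"
        using nQEw nw q c by (intro mult_left_mono order_trans[OF nQEw]) auto
      finally have "C * norm1 e \<le> C * (entry_sum L * (q * (c * (2 * (q * d) * \<eta>))))"
        using C by (rule mult_left_mono)
      then show ?thesis by (simp add: G_def mult_ac)
    qed
    have "L *\<^sub>v w = \<eta> \<cdot>\<^sub>v (L *\<^sub>v (Q *\<^sub>v r - Q *\<^sub>v (E *\<^sub>v w)))"
      using Qr QEw by (subst w_eq) (rule mult_mat_vec[OF L], auto)
    also have "L *\<^sub>v (Q *\<^sub>v r - Q *\<^sub>v (E *\<^sub>v w)) = lin E h - e"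
      unfolding lin_def e_def r_def[symmetric] by (rule mult_minus_distrib_mat_vec[OF L Qr QEw])
    finally have Lw: "F (L *\<^sub>v w) / \<eta> = F (lin E h - e)"
      using F_scale[OF \<eta>(1), of "lin E h - e"] e ell \<eta> by simp
    have "F (lin E h + - e) \<le> F (lin E h) + C * norm1 (- e)"
      by (rule F_add) (use e ell in auto)
    moreover have "lin E h + - e = lin E h - e" using e ell by auto
    moreover have "F ((lin E h - e) + e) \<le> F (lin E h - e) + C * norm1 e"
      by (rule F_add) (use e ell in auto)
    moreover have "(lin E h - e) + e = lin E h" using e ell by auto
    ultimately show ?thesis using ne Lw by (simp add: norm1_uminus)
  qed
  have upper: "(SUP w \<in> W \<eta>. ereal (F (L *\<^sub>v w) / \<eta>)) \<le> ereal (\<sigma> + G * \<eta>)"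
    if \<eta>: "0 < \<eta>" "\<eta> < \<eta>\<^sub>0" for \<eta>
  proof (rule SUP_least)
    fix w assume "w \<in> W \<eta>"
    then obtain E h where Eh: "(E, h) \<in> U" and w: "w \<in> carrier_vec N"
      and eq: "(P + \<eta> \<cdot>\<^sub>m E) *\<^sub>v (z + w) = b + \<eta> \<cdot>\<^sub>v h"
      using W[OF \<eta>(1)] by auto
    show "ereal (F (L *\<^sub>v w) / \<eta>) \<le> ereal (\<sigma> + G * \<eta>)"
      using rem[OF \<eta> Eh w eq] ub[OF Eh] by simp
  qed
  have lower: "ereal (\<sigma> - G * \<eta>) \<le> (SUP w \<in> W \<eta>. ereal (F (L *\<^sub>v w) / \<eta>))" (is "_ \<le> ?s")
    if \<eta>: "0 < \<eta>" "\<eta> < \<eta>\<^sub>0" for \<eta>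
  proof -
    have low: "ereal (F (lin E h) - G * \<eta>) \<le> ?s" if Eh: "(E, h) \<in> U" for E h
    proof -
      have "entry_sum Q * entry_sum (\<eta> \<cdot>\<^sub>m E) \<le> \<eta> * (q * c)"
        using U[OF Eh] \<eta> q by (auto simp: entry_sum_smult q_def mult_left_mono mult.left_commute)
      then have "entry_sum Q * entry_sum (\<eta> \<cdot>\<^sub>m E) < 1" using half[OF \<eta>] by simp
      then obtain w where w: "w \<in> carrier_vec N"
        and eq: "(P + \<eta> \<cdot>\<^sub>m E) *\<^sub>v (z + w) = b + \<eta> \<cdot>\<^sub>v h"
        using perturbed_solution_exists[OF P Q QP, of "\<eta> \<cdot>\<^sub>m E" z "b + \<eta> \<cdot>\<^sub>v h"] U[OF Eh] z b
        by auto
      have "ereal (F (lin E h) - G * \<eta>) \<le> ereal (F (L *\<^sub>v w) / \<eta>)"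
        using rem[OF \<eta> Eh w eq] by simp
      also have "\<dots> \<le> ?s"
        using W[OF \<eta>(1)] w eq Eh by (intro SUP_upper) auto
      finally show ?thesis .
    qed
    show ?thesis
    proof (cases ?s)
      case (real r)
      have "\<sigma> \<le> r + G * \<eta>" by (rule lub) (use low real in force)
      then show ?thesis using real by simp
    qed (use low[OF U0] in auto)
  qed
  have ev: "eventually (\<lambda>\<eta>. 0 < \<eta> \<and> \<eta> < \<eta>\<^sub>0) (at_right 0)"
    unfolding eventually_at_right_field using \<eta>\<^sub>0 by blast
  show ?thesis
  proof (rule tendsto_sandwich)
    show "((\<lambda>\<eta>. ereal (\<sigma> - G * \<eta>)) \<longlongrightarrow> ereal \<sigma>) (at_right 0)"
      by (auto intro!: tendsto_eq_intros)
    show "((\<lambda>\<eta>. ereal (\<sigma> + G * \<eta>)) \<longlongrightarrow> ereal \<sigma>) (at_right 0)"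
      by (auto intro!: tendsto_eq_intros)
  qed (use ev upper lower in \<open>auto elim!: eventually_mono\<close>)
qed

section \<open>The Euclidean and the spectral norm\<close>

lemma norm2_L2_set: "norm2 v = L2_set (($) v) {..<dim_vec v}"
  by (simp add: norm2_def L2_set_def)

lemma norm2_nonneg [simp]: "0 \<le> norm2 v"
  by (simp add: norm2_L2_set)

lemma norm2_le_norm1: "norm2 v \<le> norm1 v"
  unfolding norm2_L2_set norm1_def by (rule L2_set_le_sum_abs)

lemma norm2_smult: "norm2 (c \<cdot>\<^sub>v v) = \<bar>c\<bar> * norm2 v"
  by (simp add: norm2_def power_mult_distrib real_sqrt_mult flip: sum_distrib_left)

lemma norm2_zero [simp]: "norm2 (0\<^sub>v n) = 0"
  by (simp add: norm2_def)

lemma norm2_uminus: "norm2 (- v) = norm2 v"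
  by (simp add: norm2_def)

lemma norm2_entry_le: "i < dim_vec v \<Longrightarrow> \<bar>v $ i\<bar> \<le> norm2 v"
  unfolding norm2_def by (rule real_le_rsqrt) (simp, rule member_le_sum, auto)

lemma norm2_eq_0_iff: "norm2 v = 0 \<longleftrightarrow> v = 0\<^sub>v (dim_vec v)"
  by (auto simp: norm2_L2_set L2_set_eq_0_iff vec_eq_iff)

lemma norm2_add_le:
  assumes "u \<in> carrier_vec n" "v \<in> carrier_vec n"
  shows "norm2 (u + v) \<le> norm2 u + norm1 v"
proof -
  have "norm2 (u + v) = L2_set (\<lambda>i. u $ i + v $ i) {..<n}"
    using assms by (auto simp: norm2_L2_set intro!: L2_set_cong)
  also have "\<dots> \<le> norm2 u + norm2 v"
    using assms L2_set_triangle_ineq[of "($) u" "($) v" "{..<n}"] by (simp add: norm2_L2_set)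
  finally show ?thesis using norm2_le_norm1[of v] by simp
qed

lemma norm1_le_norm2: "norm1 v \<le> real (dim_vec v) * norm2 v"
  unfolding norm1_def using sum_bounded_above[of "{..<dim_vec v}" "\<lambda>i. \<bar>v $ i\<bar>" "norm2 v"]
  by (simp add: norm2_entry_le)

lemma norm2_append: "(norm2 (u @\<^sub>v v))\<^sup>2 = (norm2 u)\<^sup>2 + (norm2 v)\<^sup>2"
proof -
  have "(norm2 (u @\<^sub>v v))\<^sup>2 = (\<Sum>i<dim_vec u + dim_vec v. ((u @\<^sub>v v) $ i)\<^sup>2)"
    by (simp add: norm2_def sum_nonneg)
  also have "\<dots> = (\<Sum>i<dim_vec u. ((u @\<^sub>v v) $ i)\<^sup>2) +
      (\<Sum>i=dim_vec u..<dim_vec u + dim_vec v. ((u @\<^sub>v v) $ i)\<^sup>2)"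
    by (subst sum.union_disjoint[symmetric]) (auto intro!: sum.cong)
  also have "(\<Sum>i=dim_vec u..<dim_vec u + dim_vec v. ((u @\<^sub>v v) $ i)\<^sup>2) = (\<Sum>i<dim_vec v. (v $ i)\<^sup>2)"
    by (rule sum.reindex_bij_witness[of _ "\<lambda>i. i + dim_vec u" "\<lambda>i. i - dim_vec u"]) auto
  finally show ?thesis by (simp add: norm2_def sum_nonneg)
qed

lemma spectral_norm_bdd:
  "bdd_above {norm2 (X *\<^sub>v v) | v. v \<in> carrier_vec (dim_col X) \<and> norm2 v \<le> 1}"
proof (rule bdd_aboveI)
  fix a assume "a \<in> {norm2 (X *\<^sub>v v) | v. v \<in> carrier_vec (dim_col X) \<and> norm2 v \<le> 1}"
  then obtain v where v: "v \<in> carrier_vec (dim_col X)" "norm2 v \<le> 1" and a: "a = norm2 (X *\<^sub>v v)"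
    by auto
  have "a \<le> entry_sum X * norm1 v"
    unfolding a using norm2_le_norm1 norm1_mult_le[of v X] v by (force intro: order_trans)
  also have "\<dots> \<le> entry_sum X * (real (dim_col X) * 1)"
    using norm1_le_norm2[of v] v mult_left_mono[of "norm2 v" 1 "real (dim_col X)"]
    by (intro mult_left_mono) auto
  finally show "a \<le> entry_sum X * (real (dim_col X) * 1)" .
qed

lemma norm2_mult_le_spectral_norm:
  assumes v: "v \<in> carrier_vec (dim_col X)"
  shows "norm2 (X *\<^sub>v v) \<le> spectral_norm X * norm2 v"
proof (cases "norm2 v = 0")
  case True
  then have v0: "v = 0\<^sub>v (dim_col X)" using v by (auto simp: norm2_eq_0_iff)
  have "X *\<^sub>v v = 0\<^sub>v (dim_row X)" unfolding v0 by (intro eq_vecI) auto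
  then show ?thesis using True by simp
next
  case False
  then have pos: "0 < norm2 v" using norm2_nonneg[of v] by linarith
  have Xv: "X *\<^sub>v ((1 / norm2 v) \<cdot>\<^sub>v v) = (1 / norm2 v) \<cdot>\<^sub>v (X *\<^sub>v v)"
    by (rule mult_mat_vec[OF _ v, of X "dim_row X"]) auto
  have "norm2 (X *\<^sub>v ((1 / norm2 v) \<cdot>\<^sub>v v)) \<le> spectral_norm X"
    unfolding spectral_norm_def
    by (rule cSup_upper[OF _ spectral_norm_bdd])
      (use v pos in \<open>auto simp: norm2_smult intro!: exI[of _ "(1 / norm2 v) \<cdot>\<^sub>v v"]\<close>)
  then show ?thesis unfolding Xv norm2_smult using pos by (simp add: field_simps)
qed

section \<open>Weighted maximum norms\<close>

text \<open>The maximum norm with entry \<open>i\<close> measured in units of \<open>w i\<close>.\<close>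

definition wmax :: "nat \<Rightarrow> (nat \<Rightarrow> real) \<Rightarrow> real vec \<Rightarrow> real" where
  "wmax k w v = Max ((\<lambda>i. \<bar>v $ i\<bar> / w i) ` {..<k})"

lemma wmax_le_iff: "0 < k \<Longrightarrow> wmax k w v \<le> \<tau> \<longleftrightarrow> (\<forall>i<k. \<bar>v $ i\<bar> / w i \<le> \<tau>)"
  unfolding wmax_def by (subst Max_le_iff) auto

lemma wmax_ge: "i < k \<Longrightarrow> \<bar>v $ i\<bar> / w i \<le> wmax k w v"
  unfolding wmax_def by (rule Max_ge) auto

lemma wmax_add_le:
  assumes k: "0 < k" and w: "\<And>i. i < k \<Longrightarrow> 0 < w i"
    and u: "u \<in> carrier_vec k" and v: "v \<in> carrier_vec k"
  shows "wmax k w (u + v) \<le> wmax k w u + (\<Sum>i<k. 1 / w i) * norm1 v"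
  unfolding wmax_le_iff[OF k]
proof (intro allI impI)
  fix i assume i: "i < k"
  have "\<bar>(u + v) $ i\<bar> / w i \<le> \<bar>u $ i\<bar> / w i + 1 / w i * \<bar>v $ i\<bar>"
    using u v i w[OF i] by (simp add: divide_right_mono flip: add_divide_distrib)
  also have "1 / w i * \<bar>v $ i\<bar> \<le> (\<Sum>i<k. 1 / w i) * norm1 v"
  proof (rule mult_mono)
    show "1 / w i \<le> (\<Sum>i<k. 1 / w i)"
      by (rule member_le_sum) (use i w in \<open>auto simp: less_imp_le\<close>)
    show "\<bar>v $ i\<bar> \<le> norm1 v" by (rule norm1_entry_le) (use i v in auto)
    show "0 \<le> (\<Sum>i<k. 1 / w i)" by (rule sum_nonneg) (use w in \<open>auto simp: less_imp_le\<close>)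
  qed auto
  also have "\<bar>u $ i\<bar> / w i \<le> wmax k w u" by (rule wmax_ge[OF i])
  finally show "\<bar>(u + v) $ i\<bar> / w i \<le> wmax k w u + (\<Sum>i<k. 1 / w i) * norm1 v" by simp
qed

lemma Max_image_mult:
  fixes g :: "nat \<Rightarrow> real"
  assumes "0 < k" "0 \<le> c"
  shows "Max ((\<lambda>i. c * g i) ` {..<k}) = c * Max (g ` {..<k})"
  using mono_Max_commute[of "(*) c" "g ` {..<k}"] assms
  by (simp add: image_image monoI mult_left_mono lessThan_empty_iff)

lemma wmax_smult:
  assumes "0 < k" "0 < \<eta>" "v \<in> carrier_vec k"
  shows "wmax k w (\<eta> \<cdot>\<^sub>v v) = \<eta> * wmax k w v"
proof -
  have "(\<lambda>i. \<bar>(\<eta> \<cdot>\<^sub>v v) $ i\<bar> / w i) ` {..<k} = (\<lambda>i. \<eta> * (\<bar>v $ i\<bar> / w i)) ` {..<k}"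
    using assms by (intro image_cong) (auto simp: abs_mult)
  then show ?thesis using assms by (simp add: wmax_def Max_image_mult del: times_divide_eq_right)
qed

lemma wmax_const:
  assumes "0 < k" "0 < c" "v \<in> carrier_vec k"
  shows "wmax k (\<lambda>_. c) v = norm_inf v / c"
  using Max_image_mult[of k "1 / c" "\<lambda>i. \<bar>v $ i\<bar>"] assms
  by (simp add: wmax_def norm_inf_def)

lemma norm_inf_quot_vec:
  assumes k: "0 < k" and v: "v \<in> carrier_vec k" and nz: "\<And>i. i < k \<Longrightarrow> v $ i \<noteq> 0"
  shows "norm_inf (quot_vec u v) = ereal (wmax k (\<lambda>i. \<bar>v $ i\<bar>) u)"
proof -
  have "norm_inf (quot_vec u v) = Max ((\<lambda>i. ereal (\<bar>u $ i\<bar> / \<bar>v $ i\<bar>)) ` {..<k})"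
    unfolding norm_inf_def using v nz
    by (intro arg_cong[of _ _ Max] image_cong) (auto simp: quot_vec_def)
  also have "\<dots> = ereal (wmax k (\<lambda>i. \<bar>v $ i\<bar>) u)"
    using mono_Max_commute[of ereal "(\<lambda>i. \<bar>u $ i\<bar> / \<bar>v $ i\<bar>) ` {..<k}"] k
    by (simp add: wmax_def image_image monoI lessThan_empty_iff)
  finally show ?thesis .
qed

section \<open>Block inverse of the saddle point matrix\<close>

text \<open>Ring laws whose side conditions on dimensions can be discharged by simplification.\<close>

lemma mult_assoc_dim:
  fixes X Y Z :: "real mat"
  shows "dim_col X = dim_row Y \<Longrightarrow> dim_col Y = dim_row Z \<Longrightarrow> X * Y * Z = X * (Y * Z)"
  by (rule assoc_mult_mat[of _ "dim_row X" "dim_row Y" _ "dim_row Z" _ "dim_col Z"]) auto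

lemma mult_add_dim:
  fixes X Y Z :: "real mat"
  shows "dim_col X = dim_row Y \<Longrightarrow> dim_row Y = dim_row Z \<Longrightarrow> dim_col Y = dim_col Z \<Longrightarrow>
    X * (Y + Z) = X * Y + X * Z"
  by (rule mult_add_distrib_mat[of _ "dim_row X" "dim_row Y" _ "dim_col Z"]) auto

lemma minus_mult_dim:
  fixes X Y Z :: "real mat"
  shows "dim_col Y = dim_row Z \<Longrightarrow> dim_row X = dim_row Y \<Longrightarrow> dim_col X = dim_col Y \<Longrightarrow>
    (X - Y) * Z = X * Z - Y * Z"
  by (rule minus_mult_distrib_mat[of _ "dim_row X" "dim_row Z" _ _ "dim_col Z"]) auto

text \<open>A vector \<open>v\<close> in the kernel of the Schur complement yields the vector
  \<open>[- A\<^sup>-\<^sup>1 B\<^sup>T v; v]\<close> in the kernel of the saddle point matrix.\<close>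

lemma schur_complement_invertible:
  assumes A: "A \<in> carrier_mat m m" "invertible_mat A"
    and B: "B \<in> carrier_mat n m" and D: "D \<in> carrier_mat n n"
    and inv: "invertible_mat (saddle_mat A B D)"
  shows "invertible_mat (D - B * mat_inv A * B\<^sup>T)"
proof (rule invertible_matI)
  let ?S = "D - B * mat_inv A * B\<^sup>T"
  note Ai = mat_inv[OF A]
  have sad: "saddle_mat A B D \<in> carrier_mat (m + n) (m + n)"
    using A B D by (simp add: saddle_mat_def)
  have T: "B\<^sup>T \<in> carrier_mat m n" using B by simp
  have BA: "B * mat_inv A \<in> carrier_mat n m" using B Ai by simp
  show "?S \<in> carrier_mat n n" using B Ai by auto
  fix v assume v: "v \<in> carrier_vec n" and Sv: "?S *\<^sub>v v = 0\<^sub>v n"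
  define u where "u = mat_inv A *\<^sub>v (B\<^sup>T *\<^sub>v v)"
  have Tv: "B\<^sup>T *\<^sub>v v \<in> carrier_vec m" by (rule mult_mat_vec_carrier[OF T v])
  have u: "u \<in> carrier_vec m" unfolding u_def by (rule mult_mat_vec_carrier[OF Ai(1) Tv])
  have Au: "A *\<^sub>v u = B\<^sup>T *\<^sub>v v"
    using assoc_mult_mat_vec[OF A(1) Ai(1) Tv] Ai(2) Tv by (simp add: u_def)
  have Bu: "B *\<^sub>v u = B * mat_inv A * B\<^sup>T *\<^sub>v v"
    unfolding u_def assoc_mult_mat_vec[OF BA T v] assoc_mult_mat_vec[OF B Ai(1) Tv] ..
  have Dv: "D *\<^sub>v v \<in> carrier_vec n" and Buc: "B *\<^sub>v u \<in> carrier_vec n"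
    using D v B u by auto
  have DB: "D *\<^sub>v v - B *\<^sub>v u = 0\<^sub>v n"
    unfolding Bu Sv[symmetric] by (rule minus_mult_distrib_mat_vec[symmetric, OF D _ v]) (use BA T in auto)
  have "saddle_mat A B D *\<^sub>v (- u @\<^sub>v v) = (A *\<^sub>v (- u) + B\<^sup>T *\<^sub>v v) @\<^sub>v (B *\<^sub>v (- u) + D *\<^sub>v v)"
    unfolding saddle_mat_def
    by (rule four_block_mat_mult_vec[OF A(1) T B D]) (use u v in auto)
  also have "A *\<^sub>v (- u) + B\<^sup>T *\<^sub>v v = 0\<^sub>v m"
  proof -
    have "A *\<^sub>v (- u) = - (A *\<^sub>v u)" using A u by (intro eq_vecI) auto
    then show ?thesis using Au Tv by simp
  qed
  also have "B *\<^sub>v (- u) + D *\<^sub>v v = 0\<^sub>v n"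
  proof -
    have "B *\<^sub>v (- u) = - (B *\<^sub>v u)" using B u by (intro eq_vecI) auto
    then show ?thesis using DB Dv Buc by (metis minus_add_uminus_vec comm_add_vec uminus_carrier_vec)
  qed
  finally have 0: "saddle_mat A B D *\<^sub>v (- u @\<^sub>v v) = 0\<^sub>v (m + n)" by (auto simp: vec_eq_iff)
  have uv: "- u @\<^sub>v v \<in> carrier_vec (m + n)" using u v by simp
  have "- u @\<^sub>v v = mat_inv (saddle_mat A B D) *\<^sub>v (saddle_mat A B D *\<^sub>v (- u @\<^sub>v v))"
    using assoc_mult_mat_vec[OF mat_inv(1)[OF sad inv] sad uv] mat_inv(3)[OF sad inv] uv by simp
  also have "\<dots> = 0\<^sub>v (m + n)"
    unfolding 0 using mat_inv(1)[OF sad inv] by (intro eq_vecI) auto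
  finally have eq: "- u @\<^sub>v v = 0\<^sub>v (m + n)" .
  show "v = 0\<^sub>v n"
  proof (rule eq_vecI)
    fix i assume i: "i < dim_vec (0\<^sub>v n :: real vec)"
    have "(- u @\<^sub>v v) $ (m + i) = 0" unfolding eq using i by simp
    then show "v $ i = 0\<^sub>v n $ i" using i u v by simp
  qed (use v in auto)
qed

lemma saddle_mat_inverse:
  fixes A B D :: "real mat"
  assumes A: "A \<in> carrier_mat m m" "invertible_mat A"
    and B: "B \<in> carrier_mat n m" and D: "D \<in> carrier_mat n n"
    and inv: "invertible_mat (saddle_mat A B D)"
    and S_def: "S = D - B * mat_inv A * B\<^sup>T"
    and M_def: "M = mat_inv A + mat_inv A * B\<^sup>T * mat_inv S * B * mat_inv A"
    and N_def: "N = - (mat_inv A * B\<^sup>T * mat_inv S)"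
    and K_def: "K = - (mat_inv S * B * mat_inv A)"
  shows "four_block_mat M N K (mat_inv S) * saddle_mat A B D = 1\<^sub>m (m + n)"
    and "M \<in> carrier_mat m m" "N \<in> carrier_mat m n" "K \<in> carrier_mat n m"
    and "mat_inv S \<in> carrier_mat n n"
proof -
  define Ai where "Ai = mat_inv A"
  define Si where "Si = mat_inv S"
  define T where "T = B\<^sup>T"
  have Ai: "Ai \<in> carrier_mat m m" and AAi: "A * Ai = 1\<^sub>m m"
    using mat_inv[OF A] by (auto simp: Ai_def)
  have T: "T \<in> carrier_mat m n" using B by (simp add: T_def)
  have S: "S = D - B * (Ai * T)"
    using B Ai T by (simp add: S_def Ai_def T_def mult_assoc_dim)
  have Sc: "S \<in> carrier_mat n n" using B Ai T by (auto simp: S)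
  have invS: "invertible_mat S"
    unfolding S_def by (rule schur_complement_invertible[OF A B D inv])
  have Si: "Si \<in> carrier_mat n n" and SSi: "S * Si = 1\<^sub>m n"
    using mat_inv[OF Sc invS] by (auto simp: Si_def)
  define H where "H = Si * (B * Ai)"
  have H: "H \<in> carrier_mat n m" using Si B Ai by (simp add: H_def)
  note dims = carrier_matD[OF A(1)] carrier_matD[OF B] carrier_matD[OF D] carrier_matD[OF Ai]
    carrier_matD[OF T] carrier_matD[OF Si] carrier_matD[OF H]
  have M: "M = Ai + Ai * (T * H)" and N: "N = - (Ai * (T * Si))" and K: "K = - H"
    by (simp_all add: M_def N_def K_def H_def flip: Ai_def Si_def T_def)
      (simp_all add: mult_assoc_dim dims)
  show M': "M \<in> carrier_mat m m" and N': "N \<in> carrier_mat m n" and K': "K \<in> carrier_mat n m"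
    and Si': "mat_inv S \<in> carrier_mat n n"
    using Ai T H Si by (auto simp: M N K simp flip: Si_def)
  have can: "A * (Ai * X) = X" if "dim_row X = m" for X
  proof -
    have "A * (Ai * X) = A * Ai * X" using that by (simp add: mult_assoc_dim dims)
    then show ?thesis using that unfolding AAi by (metis carrier_matI left_mult_one_mat)
  qed
  \<comment> \<open>\<open>D\<close> occurs in the products only through the Schur complement.\<close>
  have DX: "D * X = S * X + B * (Ai * (T * X))" if "dim_row X = n" for X
  proof -
    have "S * X = D * X - B * (Ai * (T * X))"
      using that by (simp add: S minus_mult_dim mult_assoc_dim dims)
    then show ?thesis using that by (intro eq_matI) (auto simp: dims)
  qed
  have SH: "S * H = B * Ai"
  proof -
    have "S * H = S * Si * (B * Ai)" unfolding H_def using Sc by (simp add: mult_assoc_dim dims)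
    then show ?thesis unfolding SSi using B Ai by simp
  qed
  have e1: "A * M + T * K = 1\<^sub>m m"
    unfolding M K by (simp add: mult_add_dim dims can AAi) (rule eq_matI, auto simp: dims)
  have e2: "A * N + T * Si = 0\<^sub>m m n"
    unfolding N by (simp add: can dims) (rule eq_matI, auto simp: dims)
  have e3: "B * M + D * K = 0\<^sub>m n m"
    unfolding M K by (simp add: mult_add_dim dims DX SH) (rule eq_matI, auto simp: dims)
  have e4: "B * N + D * Si = 1\<^sub>m n"
    unfolding N by (simp add: dims DX SSi) (rule eq_matI, auto simp: dims)
  let ?P = "saddle_mat A B D" and ?Q = "four_block_mat M N K (mat_inv S)"
  have "?P * ?Q = four_block_mat (A * M + T * K) (A * N + T * Si) (B * M + D * K) (B * N + D * Si)"
    unfolding saddle_mat_def T_def[symmetric] Si_def[symmetric]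
    by (rule mult_four_block_mat[OF A(1) T B D M' N' K' Si])
  also have "\<dots> = 1\<^sub>m (m + n)" unfolding e1 e2 e3 e4 by simp
  finally have "?P * ?Q = 1\<^sub>m (m + n)" .
  then show "?Q * ?P = 1\<^sub>m (m + n)"
    by (rule mat_mult_left_right_inverse[rotated 2])
      (use A D M' Si' in \<open>auto simp: saddle_mat_def\<close>)
qed

section \<open>Kronecker products, concatenation and diagonal matrices\<close>

lemma sum_div_mod:
  fixes g :: "nat \<Rightarrow> nat \<Rightarrow> real"
  shows "(\<Sum>j<m * n. g (j div n) (j mod n)) = (\<Sum>s<m. \<Sum>r<n. g s r)"
proof -
  have "(\<Sum>s<m. \<Sum>r<n. g s r) = (\<Sum>(s, r)\<in>{..<m} \<times> {..<n}. g s r)"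
    by (rule sum.cartesian_product)
  also have "\<dots> = (\<Sum>j<m * n. g (j div n) (j mod n))"
  proof (rule sum.reindex_bij_witness[of _ "\<lambda>j. (j div n, j mod n)" "\<lambda>(s, r). s * n + r"])
    fix j assume "j \<in> {..<m * n}"
    then have "j < m * n" "0 < n" by (auto intro: Nat.gr0I)
    then show "(j div n, j mod n) \<in> {..<m} \<times> {..<n}"
      by (simp add: less_mult_imp_div_less)
  next
    fix q assume "q \<in> {..<m} \<times> {..<n}"
    then obtain s r where q: "q = (s, r)" "s < m" "r < n" by auto
    have "s * n + r < Suc s * n" using q by simp
    also have "\<dots> \<le> m * n" using q by (intro mult_right_mono) auto
    finally show "(case q of (s, r) \<Rightarrow> s * n + r) \<in> {..<m * n}" by (simp add: q)
  qed auto
  finally show ?thesis by simp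
qed

text \<open>The next two lemmas express \<open>M b\<^sup>T y\<close> and \<open>N b x\<close> through the stacked columns of \<open>b\<close>.\<close>

lemma kronecker_row_mult_vec_of_mat:
  assumes M: "M \<in> carrier_mat p m" and y: "y \<in> carrier_vec n" and b: "b \<in> carrier_mat n m"
  shows "(M \<otimes>\<^sub>K row_mat y) *\<^sub>v vec_of_mat b = M *\<^sub>v (b\<^sup>T *\<^sub>v y)"
proof (rule eq_vecI)
  fix i assume "i < dim_vec (M *\<^sub>v (b\<^sup>T *\<^sub>v y))"
  then have i: "i < p" using M by simp
  have "((M \<otimes>\<^sub>K row_mat y) *\<^sub>v vec_of_mat b) $ i =
      (\<Sum>j<m * n. M $$ (i, j div n) * y $ (j mod n) * b $$ (j mod n, j div n))"
  proof -
    have "j mod n < n" if "j < m * n" for j using that by (cases "n = 0") auto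
    then show ?thesis
      using M y b i by (auto simp: kronecker_def row_mat_def vec_of_mat_def scalar_prod_def
          mat_of_rows_index lessThan_atLeast0 mult.commute intro!: sum.cong)
  qed
  also have "\<dots> = (\<Sum>s<m. \<Sum>r<n. M $$ (i, s) * y $ r * b $$ (r, s))"
    by (rule sum_div_mod)
  also have "\<dots> = (M *\<^sub>v (b\<^sup>T *\<^sub>v y)) $ i"
    using M y b i by (auto simp: scalar_prod_def lessThan_atLeast0 sum_distrib_left mult_ac
        intro!: sum.cong)
  finally show "((M \<otimes>\<^sub>K row_mat y) *\<^sub>v vec_of_mat b) $ i = (M *\<^sub>v (b\<^sup>T *\<^sub>v y)) $ i" .
qed (use M in \<open>simp add: kronecker_def row_mat_def\<close>)

lemma row_kronecker_mult_vec_of_mat: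
  assumes N: "N \<in> carrier_mat p n" and x: "x \<in> carrier_vec m" and b: "b \<in> carrier_mat n m"
  shows "(row_mat x \<otimes>\<^sub>K N) *\<^sub>v vec_of_mat b = N *\<^sub>v (b *\<^sub>v x)"
proof (rule eq_vecI)
  fix i assume "i < dim_vec (N *\<^sub>v (b *\<^sub>v x))"
  then have i: "i < p" using N by simp
  have "((row_mat x \<otimes>\<^sub>K N) *\<^sub>v vec_of_mat b) $ i =
      (\<Sum>j<m * n. x $ (j div n) * N $$ (i, j mod n) * b $$ (j mod n, j div n))"
  proof -
    have "j div n < m" if "j < m * n" for j using that by (simp add: less_mult_imp_div_less)
    then show ?thesis
      using N x b i by (auto simp: kronecker_def row_mat_def vec_of_mat_def scalar_prod_def
          mat_of_rows_index lessThan_atLeast0 mult.commute intro!: sum.cong)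
  qed
  also have "\<dots> = (\<Sum>s<m. \<Sum>r<n. x $ s * N $$ (i, r) * b $$ (r, s))"
    by (rule sum_div_mod)
  also have "\<dots> = (\<Sum>r<n. \<Sum>s<m. x $ s * N $$ (i, r) * b $$ (r, s))"
    by (rule sum.swap)
  also have "\<dots> = (N *\<^sub>v (b *\<^sub>v x)) $ i"
    using N x b i by (auto simp: scalar_prod_def lessThan_atLeast0 sum_distrib_left mult_ac
        intro!: sum.cong)
  finally show "((row_mat x \<otimes>\<^sub>K N) *\<^sub>v vec_of_mat b) $ i = (N *\<^sub>v (b *\<^sub>v x)) $ i" .
qed (use N in \<open>simp add: kronecker_def row_mat_def\<close>)

lemma append_cols_mult_append:
  assumes "X \<in> carrier_mat p a" "Y \<in> carrier_mat p b" "u \<in> carrier_vec a" "v \<in> carrier_vec b"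
  shows "(X @\<^sub>c Y) *\<^sub>v (u @\<^sub>v v) = X *\<^sub>v u + Y *\<^sub>v v"
proof -
  have "(X @\<^sub>c Y) *\<^sub>v (u @\<^sub>v v) = (X *\<^sub>v u + Y *\<^sub>v v) @\<^sub>v (0\<^sub>m 0 a *\<^sub>v u + 0\<^sub>m 0 b *\<^sub>v v)"
    unfolding append_cols_def carrier_matD(2)[OF assms(1)] carrier_matD(2)[OF assms(2)]
    by (rule four_block_mat_mult_vec[OF assms(1,2) _ _ assms(3,4)]) auto
  then show ?thesis using assms by (auto simp: vec_eq_iff)
qed

lemma moore_penrose_diag:
  assumes nz: "\<And>i. i < dim_vec v \<Longrightarrow> v $ i \<noteq> 0"
  shows "moore_penrose (diag_of_vec v) = mat_diag (dim_vec v) (\<lambda>i. 1 / v $ i)"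
proof -
  let ?k = "dim_vec v"
  let ?A = "mat_diag ?k (\<lambda>i. v $ i)" and ?X = "mat_diag ?k (\<lambda>i. 1 / v $ i)"
  have dimA: "dim_row ?A = ?k" "dim_col ?A = ?k" by (simp_all add: mat_diag_def)
  have one: "?A * ?X = 1\<^sub>m ?k" "?X * ?A = 1\<^sub>m ?k"
    unfolding mat_diag_diag by (rule eq_matI, use nz in \<open>auto simp: mat_diag_def\<close>)+
  show ?thesis
    unfolding moore_penrose_def diag_of_vec_def dimA
  proof (rule the_equality)
    show "?X \<in> carrier_mat ?k ?k \<and> ?A * ?X * ?A = ?A \<and> ?X * ?A * ?X = ?X \<and>
      (?A * ?X)\<^sup>T = ?A * ?X \<and> (?X * ?A)\<^sup>T = ?X * ?A"
      unfolding one left_mult_one_mat[OF mat_diag_dim] by simp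
    fix Y assume "Y \<in> carrier_mat ?k ?k \<and> ?A * Y * ?A = ?A \<and> Y * ?A * Y = Y \<and>
      (?A * Y)\<^sup>T = ?A * Y \<and> (Y * ?A)\<^sup>T = Y * ?A"
    then have Y: "Y \<in> carrier_mat ?k ?k" and AYA: "?A * Y * ?A = ?A" by auto
    show "Y = ?X"
    proof (rule eq_matI)
      fix i j assume "i < dim_row ?X" "j < dim_col ?X"
      then have ij: "i < ?k" "j < ?k" by (simp_all add: mat_diag_def)
      have "?A * Y * ?A = mat ?k ?k (\<lambda>(i, j). v $ i * Y $$ (i, j) * v $ j)"
        unfolding mat_diag_mult_left[OF Y]
        by (subst mat_diag_mult_right[of _ ?k]) (auto intro!: eq_matI)
      then have "v $ i * Y $$ (i, j) * v $ j = ?A $$ (i, j)"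
        using AYA ij by (metis (no_types, lifting) case_prod_conv index_mat(1))
      then show "Y $$ (i, j) = ?X $$ (i, j)"
        using nz[OF ij(1)] nz[OF ij(2)] ij by (auto simp: mat_diag_def field_simps split: if_splits)
    qed (use Y in \<open>auto simp: mat_diag_def\<close>)
  qed
qed

section \<open>Toeplitz matrices and their parameter vectors\<close>

text \<open>The Toeplitz matrix with a given parameter vector: the position \<open>(r, s)\<close> carries the parameter
  number \<open>(s - r) + (n - 1)\<close>, where the summands are ordered so that no subtraction truncates.\<close>

definition toep_of_vec :: "nat \<Rightarrow> nat \<Rightarrow> real vec \<Rightarrow> real mat" where
  "toep_of_vec n m t = mat n m (\<lambda>(r, s). t $ (s + (n - 1) - r))"

lemma toep_of_vec_carrier [simp]: "toep_of_vec n m t \<in> carrier_mat n m"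
  by (simp add: toep_of_vec_def)

lemma toep_of_vec_dims [simp]: "dim_row (toep_of_vec n m t) = n" "dim_col (toep_of_vec n m t) = m"
  by (simp_all add: toep_of_vec_def)

lemma toep_of_vec_index:
  "r < n \<Longrightarrow> s < m \<Longrightarrow> toep_of_vec n m t $$ (r, s) = t $ (s + (n - 1) - r)"
  by (simp add: toep_of_vec_def)

lemma toep_of_vec_toeplitz: "0 < n \<Longrightarrow> toep_of_vec n m t \<in> toeplitz_mats n m"
  unfolding toeplitz_mats_def
  by (auto simp: toep_of_vec_index nat_diff_distrib intro!: exI[of _ "\<lambda>l. t $ nat (l + (int n - 1))"]
      arg_cong[where f = "\<lambda>i. t $ i"])

lemma vec_toep_dim: "T \<in> carrier_mat n m \<Longrightarrow> dim_vec (vec_toep T) = m + n - 1"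
  by (auto simp: vec_toep_def Let_def)

lemma vec_toep_carrier: "T \<in> carrier_mat n m \<Longrightarrow> vec_toep T \<in> carrier_vec (m + n - 1)"
  by (rule carrier_vecI) (rule vec_toep_dim)

lemma vec_toep_of_vec:
  assumes "0 < n" "0 < m" "t \<in> carrier_vec (m + n - 1)"
  shows "vec_toep (toep_of_vec n m t) = t"
  using assms by (intro eq_vecI) (auto simp: vec_toep_def Let_def toep_of_vec_index)

lemma toep_of_vec_vec_toep:
  assumes "0 < n" "0 < m" "T \<in> toeplitz_mats n m"
  shows "toep_of_vec n m (vec_toep T) = T"
proof -
  from assms obtain t :: "int \<Rightarrow> real" where T: "T \<in> carrier_mat n m"
    and t: "\<And>r s. r < n \<Longrightarrow> s < m \<Longrightarrow> T $$ (r, s) = t (int s - int r)"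
    unfolding toeplitz_mats_def by auto
  show ?thesis
  proof (rule eq_matI)
    fix r s assume "r < dim_row T" "s < dim_col T"
    then have rs: "r < n" "s < m" using T by auto
    define p where "p = s + (n - 1) - r"
    have p: "p < m + n - 1" "int s - int r = int p - (int n - 1)" using rs by (auto simp: p_def)
    have "vec_toep T $ p = t (int p - (int n - 1))"
      using p(1) T assms t[of "n - 1 - p" 0] t[of 0 "p - (n - 1)"]
      by (auto simp: vec_toep_def Let_def of_nat_diff algebra_simps)
    then have "vec_toep T $ p = t (int s - int r)" unfolding p(2) .
    then show "toep_of_vec n m (vec_toep T) $$ (r, s) = T $$ (r, s)"
      using rs t by (simp add: toep_of_vec_index p_def)
  qed (use T in auto)
qed

lemma vec_toep_abs: "0 < dim_row T \<Longrightarrow> 0 < dim_col T \<Longrightarrow> vec_toep (abs_mat T) = abs_vec (vec_toep T)"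
  by (rule eq_vecI) (auto simp: vec_toep_def Let_def)

lemma toep_Phi_carrier: "toep_Phi n m \<in> carrier_mat (n * m) (m + n - 1)"
  by (rule carrier_matI) (simp_all add: toep_Phi_def)

lemma toep_Phi_mult_vec_toep:
  assumes "0 < n" "0 < m" "t \<in> carrier_vec (m + n - 1)"
  shows "toep_Phi n m *\<^sub>v t = vec_of_mat (toep_of_vec n m t)"
proof (rule eq_vecI)
  fix i assume "i < dim_vec (vec_of_mat (toep_of_vec n m t))"
  then have i: "i < n * m" by (simp add: vec_of_mat_def)
  define r where "r = i mod n"
  define s where "s = i div n"
  define q where "q = s + (n - 1) - r"
  have rs: "r < n" "s < m"
    using i assms by (auto simp: r_def s_def less_mult_imp_div_less mult.commute)
  have q: "q < m + n - 1" using rs by (auto simp: q_def)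
  have pos: "(r, s) \<in> toep_positions n m p \<longleftrightarrow> p = q" for p
    using rs by (auto simp: toep_positions_def q_def)
  have "(toep_Phi n m *\<^sub>v t) $ i = (\<Sum>p<m + n - 1. (if p = q then 1 else 0) * t $ p)"
  proof -
    have "toep_Phi n m $$ (i, p) = (if p = q then 1 else 0)" if "p < m + n - 1" for p
      using that i rs pos[of p]
      by (simp add: toep_Phi_def mat_of_cols_index vec_of_mat_def toep_basis_def mult.commute
          r_def s_def)
    then show ?thesis
      using i assms carrier_matD[OF toep_Phi_carrier[of n m]]
      by (auto simp: scalar_prod_def lessThan_atLeast0 intro!: sum.cong)
  qed
  also have "\<dots> = t $ q" using q by (simp add: if_distrib[of "\<lambda>c. c * _"] cong: if_cong)
  also have "\<dots> = vec_of_mat (toep_of_vec n m t) $ i"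
    using i rs by (simp add: vec_of_mat_def toep_of_vec_index q_def r_def s_def)
  finally show "(toep_Phi n m *\<^sub>v t) $ i = vec_of_mat (toep_of_vec n m t) $ i" .
qed (simp add: toep_Phi_def vec_of_mat_def)

lemma toep_D_carrier: "toep_D n m \<in> carrier_mat (m + n - 1) (m + n - 1)"
  by (simp add: toep_D_def)

lemma toep_D_invertible:
  assumes "0 < n" "0 < m"
  shows "invertible_mat (toep_D n m)"
proof (rule invertible_matI[OF toep_D_carrier])
  fix v assume v: "v \<in> carrier_vec (m + n - 1)" and 0: "toep_D n m *\<^sub>v v = 0\<^sub>v (m + n - 1)"
  show "v = 0\<^sub>v (m + n - 1)"
  proof (rule eq_vecI)
    fix p assume "p < dim_vec (0\<^sub>v (m + n - 1) :: real vec)"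
    then have p: "p < m + n - 1" by simp
    \<comment> \<open>Each diagonal meets the first column or the first row, so its length is positive.\<close>
    have "(if p < n - 1 then (n - 1 - p, 0) else (0, p - (n - 1))) \<in> toep_positions n m p"
      using assms p by (auto simp: toep_positions_def of_nat_diff)
    moreover have "finite (toep_positions n m p)"
      by (rule finite_subset[of _ "{..<n} \<times> {..<m}"]) (auto simp: toep_positions_def)
    ultimately have c: "0 < card (toep_positions n m p)" by (auto simp: card_gt_0_iff)
    have "(toep_D n m *\<^sub>v v) $ p = sqrt (real (card (toep_positions n m p))) * v $ p"
      using p v unfolding toep_D_def mat_diag_def
      by (simp add: scalar_prod_def if_distrib[of "\<lambda>c. c * _"] cong: if_cong)
    then show "v $ p = 0\<^sub>v (m + n - 1) $ p" using c p unfolding 0 by simp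
  qed (use v in auto)
qed

lemma frob_norm_pair_toep_of_vec:
  assumes "0 < n" "0 < m" "t \<in> carrier_vec (m + n - 1)"
  shows "frob_norm_pair (toep_of_vec n m t) g = norm2 ((toep_D n m *\<^sub>v t) @\<^sub>v g)"
proof -
  have "frob_norm (toep_of_vec n m t) = norm2 (toep_D n m *\<^sub>v t)"
    using frob_norm_toeplitz[OF assms(1,2) toep_of_vec_toeplitz[OF assms(1)]]
    by (simp add: vec_toep_of_vec assms del: One_nat_def)
  then show ?thesis
    by (simp add: frob_norm_pair_def real_sqrt_unique flip: norm2_append)
qed

section \<open>The linear part of the solution change\<close>

text \<open>A nonsingular saddle point problem with solution \<open>z\<close>, together with the matrices that describe
  the inverse and the derivative of the solution.\<close>

locale saddle_problem =
  fixes A B D L S M N K R :: "real mat" and f x y z :: "real vec" and m n k :: nat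
  assumes pos: "0 < m" "0 < n"
    and A: "A \<in> carrier_mat m m" "invertible_mat A"
    and B: "B \<in> toeplitz_mats n m"
    and D: "D \<in> carrier_mat n n"
    and f: "f \<in> carrier_vec m"
    and x: "x \<in> carrier_vec m"
    and y: "y \<in> carrier_vec n"
    and L: "L \<in> carrier_mat k (m + n)"
    and nonsing: "invertible_mat (saddle_mat A B D)"
    and z_def: "z = x @\<^sub>v y"
    and sol: "saddle_mat A B D *\<^sub>v z = f @\<^sub>v 0\<^sub>v n"
    and S_def: "S = D - B * mat_inv A * B\<^sup>T"
    and M_def: "M = mat_inv A + mat_inv A * B\<^sup>T * mat_inv S * B * mat_inv A"
    and N_def: "N = - (mat_inv A * B\<^sup>T * mat_inv S)"
    and K_def: "K = - (mat_inv S * B * mat_inv A)"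
    and R_def: "R = (M \<otimes>\<^sub>K row_mat y + row_mat x \<otimes>\<^sub>K N) @\<^sub>r
                    (K \<otimes>\<^sub>K row_mat y + row_mat x \<otimes>\<^sub>K mat_inv S)"
    and Lz: "L *\<^sub>v z \<noteq> 0\<^sub>v k"
begin

text \<open>The inverse of the saddle point matrix.\<close>

definition Q :: "real mat" where
  "Q = four_block_mat M N K (mat_inv S)"

text \<open>The coefficients, up to sign, of the Toeplitz parameters of \<open>\<Delta>B\<close> in the linear part of \<open>L \<Delta>z\<close>.\<close>

definition GT :: "real mat" where
  "GT = L * R * toep_Phi n m"

text \<open>The coefficients of \<open>\<Delta>f\<close> in the linear part of \<open>L \<Delta>z\<close>.\<close>

definition GF :: "real mat" where
  "GF = L * (M @\<^sub>r K)"

text \<open>The linear part of \<open>L \<Delta>z\<close>, as a function of the Toeplitz parameters of \<open>\<Delta>B\<close> and of \<open>\<Delta>f\<close>.\<close>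

definition lin :: "real vec \<Rightarrow> real vec \<Rightarrow> real vec" where
  "lin t g = GF *\<^sub>v g - GT *\<^sub>v t"

lemma B_carrier: "B \<in> carrier_mat n m"
  using B by (simp add: toeplitz_mats_def)

lemmas blocks = saddle_mat_inverse(2-5)[OF A B_carrier D nonsing S_def M_def N_def K_def]

lemma Q_saddle: "Q * saddle_mat A B D = 1\<^sub>m (m + n)"
  unfolding Q_def by (rule saddle_mat_inverse(1)[OF A B_carrier D nonsing S_def M_def N_def K_def])

lemma saddle_carrier: "saddle_mat A B D \<in> carrier_mat (m + n) (m + n)"
  using A D by (simp add: saddle_mat_def)

lemma Q_carrier: "Q \<in> carrier_mat (m + n) (m + n)"
  using blocks by (simp add: Q_def)

lemma z_carrier: "z \<in> carrier_vec (m + n)"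
  using x y by (simp add: z_def)

lemma R_blocks:
  shows "M \<otimes>\<^sub>K row_mat y + row_mat x \<otimes>\<^sub>K N \<in> carrier_mat m (n * m)"
    and "K \<otimes>\<^sub>K row_mat y + row_mat x \<otimes>\<^sub>K mat_inv S \<in> carrier_mat n (n * m)"
    and "M \<otimes>\<^sub>K row_mat y \<in> carrier_mat m (n * m)"
    and "row_mat x \<otimes>\<^sub>K N \<in> carrier_mat m (n * m)"
    and "K \<otimes>\<^sub>K row_mat y \<in> carrier_mat n (n * m)"
    and "row_mat x \<otimes>\<^sub>K mat_inv S \<in> carrier_mat n (n * m)"
  using carrier_matD[OF blocks(1)] carrier_matD[OF blocks(2)] carrier_matD[OF blocks(3)]
    carrier_matD[OF blocks(4)] x y
  by (auto simp: kronecker_def row_mat_def mult.commute intro!: carrier_matI)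

lemma R_carrier: "R \<in> carrier_mat (m + n) (n * m)"
  unfolding R_def by (rule carrier_append_rows[OF R_blocks(1,2)])

lemma MK_carrier: "M @\<^sub>r K \<in> carrier_mat (m + n) m"
  by (rule carrier_append_rows[OF blocks(1,3)])

lemma GT_carrier: "GT \<in> carrier_mat k (m + n - 1)"
  unfolding GT_def using L R_carrier toep_Phi_carrier by (meson mult_carrier_mat)

lemma GF_carrier: "GF \<in> carrier_mat k m"
  unfolding GF_def using L MK_carrier by (rule mult_carrier_mat)

lemma R_mult_vec_of_mat:
  assumes b: "b \<in> carrier_mat n m"
  shows "R *\<^sub>v vec_of_mat b = Q *\<^sub>v ((b\<^sup>T *\<^sub>v y) @\<^sub>v (b *\<^sub>v x))"
proof -
  have v: "vec_of_mat b \<in> carrier_vec (n * m)"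
    using b by (intro carrier_vecI) (simp add: vec_of_mat_def)
  have by': "b\<^sup>T *\<^sub>v y \<in> carrier_vec m" and bx: "b *\<^sub>v x \<in> carrier_vec n"
    using b x y by auto
  have "R *\<^sub>v vec_of_mat b =
      (M *\<^sub>v (b\<^sup>T *\<^sub>v y) + N *\<^sub>v (b *\<^sub>v x)) @\<^sub>v (K *\<^sub>v (b\<^sup>T *\<^sub>v y) + mat_inv S *\<^sub>v (b *\<^sub>v x))"
    unfolding R_def mat_mult_append[OF R_blocks(1,2) v]
      add_mult_distrib_mat_vec[OF R_blocks(3,4) v] add_mult_distrib_mat_vec[OF R_blocks(5,6) v]
      kronecker_row_mult_vec_of_mat[OF blocks(1) y b] kronecker_row_mult_vec_of_mat[OF blocks(3) y b]
      row_kronecker_mult_vec_of_mat[OF blocks(2) x b] row_kronecker_mult_vec_of_mat[OF blocks(4) x b] ..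
  also have "\<dots> = Q *\<^sub>v ((b\<^sup>T *\<^sub>v y) @\<^sub>v (b *\<^sub>v x))"
    unfolding Q_def by (rule four_block_mat_mult_vec[symmetric, OF blocks by' bx])
  finally show ?thesis .
qed

text \<open>The change of the saddle point matrix caused by the Toeplitz perturbation with parameters \<open>t\<close>.\<close>

definition pert_mat :: "real vec \<Rightarrow> real mat" where
  "pert_mat t = saddle_mat (0\<^sub>m m m) (toep_of_vec n m t) (0\<^sub>m n n)"

lemma pert_mat_carrier: "pert_mat t \<in> carrier_mat (m + n) (m + n)"
  unfolding pert_mat_def saddle_mat_def by (rule four_block_carrier_mat) auto

lemma linear_part:
  assumes t: "t \<in> carrier_vec (m + n - 1)" and g: "g \<in> carrier_vec m"
  shows "L *\<^sub>v (Q *\<^sub>v ((g @\<^sub>v 0\<^sub>v n) - pert_mat t *\<^sub>v z)) = lin t g"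
proof -
  let ?b = "toep_of_vec n m t"
  have b: "?b \<in> carrier_mat n m" by simp
  have bT: "?b\<^sup>T \<in> carrier_mat m n" by simp
  have by': "?b\<^sup>T *\<^sub>v y \<in> carrier_vec m" and bx: "?b *\<^sub>v x \<in> carrier_vec n"
    using mult_mat_vec_carrier[OF bT y] mult_mat_vec_carrier[OF b x] by auto
  have g0: "g @\<^sub>v 0\<^sub>v n \<in> carrier_vec (m + n)" using g by simp
  have bb: "(?b\<^sup>T *\<^sub>v y) @\<^sub>v (?b *\<^sub>v x) \<in> carrier_vec (m + n)"
    using by' bx by (rule append_carrier_vec)
  have "pert_mat t *\<^sub>v z = (0\<^sub>m m m *\<^sub>v x + ?b\<^sup>T *\<^sub>v y) @\<^sub>v (?b *\<^sub>v x + 0\<^sub>m n n *\<^sub>v y)"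
    unfolding pert_mat_def saddle_mat_def z_def
    by (rule four_block_mat_mult_vec[OF _ bT b _ x y]) auto
  also have "0\<^sub>m m m *\<^sub>v x + ?b\<^sup>T *\<^sub>v y = ?b\<^sup>T *\<^sub>v y" using by' x by (intro eq_vecI) auto
  also have "?b *\<^sub>v x + 0\<^sub>m n n *\<^sub>v y = ?b *\<^sub>v x" using bx y by (intro eq_vecI) auto
  finally have Ez: "pert_mat t *\<^sub>v z = (?b\<^sup>T *\<^sub>v y) @\<^sub>v (?b *\<^sub>v x)" .
  have QE: "Q *\<^sub>v (pert_mat t *\<^sub>v z) = (R * toep_Phi n m) *\<^sub>v t"
    unfolding Ez R_mult_vec_of_mat[OF b, symmetric] toep_Phi_mult_vec_toep[OF pos(2,1) t, symmetric]
    by (rule assoc_mult_mat_vec[symmetric, OF R_carrier toep_Phi_carrier t])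
  have Qg: "Q *\<^sub>v (g @\<^sub>v 0\<^sub>v n) = (M @\<^sub>r K) *\<^sub>v g"
  proof -
    have "Q *\<^sub>v (g @\<^sub>v 0\<^sub>v n) = (M *\<^sub>v g + N *\<^sub>v 0\<^sub>v n) @\<^sub>v (K *\<^sub>v g + mat_inv S *\<^sub>v 0\<^sub>v n)"
      unfolding Q_def by (rule four_block_mat_mult_vec[OF blocks g]) simp
    also have "M *\<^sub>v g + N *\<^sub>v 0\<^sub>v n = M *\<^sub>v g"
      using blocks(1,2) by (intro eq_vecI) auto
    also have "K *\<^sub>v g + mat_inv S *\<^sub>v 0\<^sub>v n = K *\<^sub>v g"
      using blocks(3,4) by (intro eq_vecI) auto
    finally show ?thesis unfolding mat_mult_append[OF blocks(1,3) g] .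
  qed
  have RPhi: "R * toep_Phi n m \<in> carrier_mat (m + n) (m + n - 1)"
    using R_carrier toep_Phi_carrier by (rule mult_carrier_mat)
  have "Q *\<^sub>v ((g @\<^sub>v 0\<^sub>v n) - pert_mat t *\<^sub>v z) = (M @\<^sub>r K) *\<^sub>v g - (R * toep_Phi n m) *\<^sub>v t"
    unfolding QE[symmetric] Qg[symmetric]
    by (rule mult_minus_distrib_mat_vec[OF Q_carrier g0]) (unfold Ez, rule bb)
  also have "L *\<^sub>v \<dots> = L *\<^sub>v ((M @\<^sub>r K) *\<^sub>v g) - L *\<^sub>v ((R * toep_Phi n m) *\<^sub>v t)"
    by (rule mult_minus_distrib_mat_vec[OF L])
      (rule mult_mat_vec_carrier[OF MK_carrier g] mult_mat_vec_carrier[OF RPhi t])+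
  also have "\<dots> = lin t g"
    unfolding lin_def GF_def GT_def assoc_mult_mat_vec[OF L MK_carrier g]
      assoc_mult_mat[OF L R_carrier toep_Phi_carrier] assoc_mult_mat_vec[OF L RPhi t] ..
  finally show ?thesis .
qed

lemma pert_mat_smult: "t \<in> carrier_vec (m + n - 1) \<Longrightarrow> \<eta> \<cdot>\<^sub>m pert_mat t = pert_mat (\<eta> \<cdot>\<^sub>v t)"
  unfolding pert_mat_def saddle_mat_def
  by (rule eq_matI) (auto simp: toep_of_vec_index)

lemma saddle_mat_add:
  "saddle_mat A (B + toep_of_vec n m t) D = saddle_mat A B D + pert_mat t"
  using A(1) B_carrier D unfolding pert_mat_def saddle_mat_def
  by (intro eq_matI) auto

text \<open>The specialisation of \<open>first_order_limit\<close> to the saddle point problem, for any notion \<open>adm\<close> of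
  admissible perturbation that scales with \<open>\<eta>\<close>, is bounded and admits the zero perturbation.\<close>

lemma condition_limit:
  fixes F :: "real vec \<Rightarrow> real" and adm :: "real \<Rightarrow> real mat \<Rightarrow> real vec \<Rightarrow> bool"
  assumes C: "0 \<le> C"
    and F_add: "\<And>u v. u \<in> carrier_vec k \<Longrightarrow> v \<in> carrier_vec k \<Longrightarrow> F (u + v) \<le> F u + C * norm1 v"
    and F_scale: "\<And>\<eta> u. 0 < \<eta> \<Longrightarrow> u \<in> carrier_vec k \<Longrightarrow> F (\<eta> \<cdot>\<^sub>v u) = \<eta> * F u"
    and adm_scale: "\<And>\<eta> t g. 0 < \<eta> \<Longrightarrow> t \<in> carrier_vec (m + n - 1) \<Longrightarrow> g \<in> carrier_vec m \<Longrightarrow>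
       adm \<eta> (toep_of_vec n m (\<eta> \<cdot>\<^sub>v t)) (\<eta> \<cdot>\<^sub>v g) \<longleftrightarrow> adm 1 (toep_of_vec n m t) g"
    and adm_zero: "adm 1 (toep_of_vec n m (0\<^sub>v (m + n - 1))) (0\<^sub>v m)"
    and adm_bound: "\<And>t g. t \<in> carrier_vec (m + n - 1) \<Longrightarrow> g \<in> carrier_vec m \<Longrightarrow>
       adm 1 (toep_of_vec n m t) g \<Longrightarrow> norm1 t \<le> c \<and> norm1 g \<le> c"
    and ub: "\<And>t g. t \<in> carrier_vec (m + n - 1) \<Longrightarrow> g \<in> carrier_vec m \<Longrightarrow>
       adm 1 (toep_of_vec n m t) g \<Longrightarrow> F (lin t g) \<le> \<sigma>"
    and lub: "\<And>\<tau>. (\<And>t g. t \<in> carrier_vec (m + n - 1) \<Longrightarrow> g \<in> carrier_vec m \<Longrightarrow>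
       adm 1 (toep_of_vec n m t) g \<Longrightarrow> F (lin t g) \<le> \<tau>) \<Longrightarrow> \<sigma> \<le> \<tau>"
  shows "((\<lambda>\<eta>. SUP w \<in> solution_changes A B D f z (adm \<eta>). ereal (F (L *\<^sub>v w) / \<eta>)) \<longlongrightarrow> ereal \<sigma>)
    (at_right 0)"
proof -
  define U where "U = {(pert_mat t, g @\<^sub>v 0\<^sub>v n) | t g. t \<in> carrier_vec (m + n - 1) \<and> g \<in> carrier_vec m \<and>
    adm 1 (toep_of_vec n m t) g}"
  define c' where "c' = max c (real (m + n) * (real (m + n) * c))"
  have U0: "(pert_mat (0\<^sub>v (m + n - 1)), 0\<^sub>v m @\<^sub>v 0\<^sub>v n) \<in> U"
    unfolding U_def mem_Collect_eq
    by (rule exI[of _ "0\<^sub>v (m + n - 1)"], rule exI[of _ "0\<^sub>v m"]) (use adm_zero in simp)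
  have changes: "solution_changes A B D f z (adm \<eta>) = {w \<in> carrier_vec (m + n). \<exists>(E, h) \<in> U.
      (saddle_mat A B D + \<eta> \<cdot>\<^sub>m E) *\<^sub>v (z + w) = (f @\<^sub>v 0\<^sub>v n) + \<eta> \<cdot>\<^sub>v h}" (is "?l = ?r")
    if \<eta>: "0 < \<eta>" for \<eta>
  proof -
    have vec: "(f @\<^sub>v 0\<^sub>v n) + \<eta> \<cdot>\<^sub>v (g @\<^sub>v 0\<^sub>v n) = (f + \<eta> \<cdot>\<^sub>v g) @\<^sub>v 0\<^sub>v n"
      if "g \<in> carrier_vec m" for g
      using that f by (intro eq_vecI) auto
    have dims: "dim_vec z = m + n" "dim_row B = n" "dim_col B = m" "dim_vec f = m"
      using z_carrier B_carrier f by auto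
    show ?thesis
    proof (intro equalityI subsetI)
      fix w assume "w \<in> ?l"
      then obtain b d where w: "w \<in> carrier_vec (m + n)" and b: "b \<in> toeplitz_mats n m"
        and d: "d \<in> carrier_vec m" and ad: "adm \<eta> b d"
        and eq: "saddle_mat A (B + b) D *\<^sub>v (z + w) = (f + d) @\<^sub>v 0\<^sub>v n"
        unfolding solution_changes_def dims by auto
      define t where "t = (1 / \<eta>) \<cdot>\<^sub>v vec_toep b"
      define g where "g = (1 / \<eta>) \<cdot>\<^sub>v d"
      have bc: "b \<in> carrier_mat n m" using b by (simp add: toeplitz_mats_def)
      have t: "t \<in> carrier_vec (m + n - 1)" using vec_toep_carrier[OF bc] by (simp add: t_def)
      have g: "g \<in> carrier_vec m" using d by (simp add: g_def)
      have tb: "toep_of_vec n m (\<eta> \<cdot>\<^sub>v t) = b"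
        using \<eta> toep_of_vec_vec_toep[OF pos(2,1) b] by (simp add: t_def smult_smult_assoc)
      have gd: "\<eta> \<cdot>\<^sub>v g = d" using \<eta> by (simp add: g_def smult_smult_assoc)
      have "(pert_mat t, g @\<^sub>v 0\<^sub>v n) \<in> U"
        unfolding U_def using t g adm_scale[OF \<eta> t g] ad by (auto simp: tb gd)
      moreover have "(saddle_mat A B D + \<eta> \<cdot>\<^sub>m pert_mat t) *\<^sub>v (z + w) = (f @\<^sub>v 0\<^sub>v n) + \<eta> \<cdot>\<^sub>v (g @\<^sub>v 0\<^sub>v n)"
        unfolding pert_mat_smult[OF t] saddle_mat_add[symmetric] tb vec[OF g] gd by (rule eq)
      ultimately show "w \<in> ?r" using w by blast
    next
      fix w assume "w \<in> ?r"
      then obtain t g where w: "w \<in> carrier_vec (m + n)" and t: "t \<in> carrier_vec (m + n - 1)"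
        and g: "g \<in> carrier_vec m" and ad: "adm 1 (toep_of_vec n m t) g"
        and eq: "(saddle_mat A B D + \<eta> \<cdot>\<^sub>m pert_mat t) *\<^sub>v (z + w) = (f @\<^sub>v 0\<^sub>v n) + \<eta> \<cdot>\<^sub>v (g @\<^sub>v 0\<^sub>v n)"
        unfolding U_def by blast
      have "adm \<eta> (toep_of_vec n m (\<eta> \<cdot>\<^sub>v t)) (\<eta> \<cdot>\<^sub>v g)" using adm_scale[OF \<eta> t g] ad by simp
      moreover have "saddle_mat A (B + toep_of_vec n m (\<eta> \<cdot>\<^sub>v t)) D *\<^sub>v (z + w) = (f + \<eta> \<cdot>\<^sub>v g) @\<^sub>v 0\<^sub>v n"
        using eq unfolding pert_mat_smult[OF t] saddle_mat_add[symmetric] vec[OF g] .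
      moreover have "toep_of_vec n m (\<eta> \<cdot>\<^sub>v t) \<in> toeplitz_mats n m"
        by (rule toep_of_vec_toeplitz[OF pos(2)])
      moreover have "\<eta> \<cdot>\<^sub>v g \<in> carrier_vec m" using g by simp
      ultimately show "w \<in> ?l" using w unfolding solution_changes_def dims by blast
    qed
  qed
  have bound: "E \<in> carrier_mat (m + n) (m + n) \<and> h \<in> carrier_vec (m + n) \<and>
      entry_sum E \<le> c' \<and> norm1 h \<le> c'" if Eh: "(E, h) \<in> U" for E h
  proof -
    from Eh obtain t g where E: "E = pert_mat t" and h: "h = g @\<^sub>v 0\<^sub>v n" and t: "t \<in> carrier_vec (m + n - 1)"
      and g: "g \<in> carrier_vec m" and ad: "adm 1 (toep_of_vec n m t) g"
      unfolding U_def by auto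
    from adm_bound[OF t g ad] have tc: "norm1 t \<le> c" and gc: "norm1 g \<le> c" by auto
    have c0: "0 \<le> c" using tc norm1_nonneg[of t] by linarith
    have T: "\<bar>toep_of_vec n m t $$ (r, s)\<bar> \<le> c" if "r < n" "s < m" for r s
      unfolding toep_of_vec_index[OF that] using t that
      by (intro order_trans[OF norm1_entry_le tc]) auto
    have Ec: "dim_row (pert_mat t) = m + n" "dim_col (pert_mat t) = m + n"
      using pert_mat_carrier[of t] by auto
    have "entry_sum (pert_mat t) \<le> real (dim_row (pert_mat t)) * (real (dim_col (pert_mat t)) * c)"
    proof (rule entry_sum_le)
      fix i j assume "i < dim_row (pert_mat t)" "j < dim_col (pert_mat t)"
      then show "\<bar>pert_mat t $$ (i, j)\<bar> \<le> c"
        using c0 T unfolding Ec by (auto simp: pert_mat_def saddle_mat_def)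
    qed
    moreover have "norm1 h = norm1 g" unfolding h norm1_append by (simp add: norm1_def)
    ultimately show ?thesis
      using pert_mat_carrier[of t] g gc unfolding Ec by (auto simp: E h c'_def)
  qed
  show ?thesis
  proof (rule first_order_limit[OF saddle_carrier Q_carrier Q_saddle L z_carrier _ sol bound _ C
        F_add F_scale _ _ changes])
    show "f @\<^sub>v 0\<^sub>v n \<in> carrier_vec (m + n)" using f by simp
    show "U \<noteq> {}" using U0 by auto
    show "F (L *\<^sub>v (Q *\<^sub>v (h - E *\<^sub>v z))) \<le> \<sigma>" if "(E, h) \<in> U" for E h
      using that ub by (auto simp: U_def linear_part)
    show "\<sigma> \<le> \<tau>" if "\<And>E h. (E, h) \<in> U \<Longrightarrow> F (L *\<^sub>v (Q *\<^sub>v (h - E *\<^sub>v z))) \<le> \<tau>" for \<tau>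
    proof (rule lub)
      fix t g assume tg: "t \<in> carrier_vec (m + n - 1)" "g \<in> carrier_vec m" "adm 1 (toep_of_vec n m t) g"
      then have "(pert_mat t, g @\<^sub>v 0\<^sub>v n) \<in> U" by (auto simp: U_def)
      from that[OF this] show "F (lin t g) \<le> \<tau>" using tg by (simp add: linear_part)
    qed
  qed auto
qed

section \<open>Maximising the linear part\<close>

text \<open>The matrix whose spectral norm occurs in the normwise condition number.\<close>

definition G :: "real mat" where
  "G = L * ((R * toep_Phi n m * mat_inv (toep_D n m)) @\<^sub>c (- (M @\<^sub>r K)))"

abbreviation "Di \<equiv> mat_inv (toep_D n m)"

lemmas Di = mat_inv[OF toep_D_carrier toep_D_invertible[OF pos(2,1)]]

text \<open>In the scaled variables the linear part is the application of \<open>G\<close>, up to sign.\<close>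

lemma G_mult:
  assumes t: "t \<in> carrier_vec (m + n - 1)" and g: "g \<in> carrier_vec m"
  shows "G *\<^sub>v ((toep_D n m *\<^sub>v t) @\<^sub>v g) = - lin t g"
proof -
  have RPhi: "R * toep_Phi n m \<in> carrier_mat (m + n) (m + n - 1)"
    using R_carrier toep_Phi_carrier by (rule mult_carrier_mat)
  have RPD: "R * toep_Phi n m * Di \<in> carrier_mat (m + n) (m + n - 1)"
    using RPhi Di(1) by (rule mult_carrier_mat)
  have MK: "- (M @\<^sub>r K) \<in> carrier_mat (m + n) m" using MK_carrier by simp
  have Dt: "toep_D n m *\<^sub>v t \<in> carrier_vec (m + n - 1)"
    by (rule mult_mat_vec_carrier[OF toep_D_carrier t])
  have cc: "(R * toep_Phi n m * Di) @\<^sub>c (- (M @\<^sub>r K)) \<in> carrier_mat (m + n) (m + n - 1 + m)"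
    unfolding append_cols_def
    using RPD MK by (metis add.right_neutral carrier_matD(2) four_block_carrier_mat zero_carrier_mat)
  have "(R * toep_Phi n m * Di) *\<^sub>v (toep_D n m *\<^sub>v t) = (R * toep_Phi n m) *\<^sub>v t"
    unfolding assoc_mult_mat_vec[OF RPhi Di(1) Dt] assoc_mult_mat_vec[OF Di(1) toep_D_carrier t, symmetric]
      Di(3) using t by simp
  moreover have "- (M @\<^sub>r K) *\<^sub>v g = - ((M @\<^sub>r K) *\<^sub>v g)"
    using MK_carrier g by (intro uminus_mult_mat_vec) auto
  ultimately have "((R * toep_Phi n m * Di) @\<^sub>c (- (M @\<^sub>r K))) *\<^sub>v ((toep_D n m *\<^sub>v t) @\<^sub>v g) =
      (R * toep_Phi n m) *\<^sub>v t + - ((M @\<^sub>r K) *\<^sub>v g)"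
    using append_cols_mult_append[OF RPD MK Dt g] by simp
  then have "G *\<^sub>v ((toep_D n m *\<^sub>v t) @\<^sub>v g) = L *\<^sub>v ((R * toep_Phi n m) *\<^sub>v t + - ((M @\<^sub>r K) *\<^sub>v g))"
    unfolding G_def using assoc_mult_mat_vec[OF L cc append_carrier_vec[OF Dt g]] by simp
  also have "\<dots> = L *\<^sub>v ((R * toep_Phi n m) *\<^sub>v t - (M @\<^sub>r K) *\<^sub>v g)"
    using mult_mat_vec_carrier[OF RPhi t] mult_mat_vec_carrier[OF MK_carrier g]
    by (metis minus_add_uminus_vec)
  also have "\<dots> = L *\<^sub>v ((R * toep_Phi n m) *\<^sub>v t) - L *\<^sub>v ((M @\<^sub>r K) *\<^sub>v g)"
    by (rule mult_minus_distrib_mat_vec[OF L])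
      (rule mult_mat_vec_carrier[OF MK_carrier g] mult_mat_vec_carrier[OF RPhi t])+
  also have "\<dots> = GT *\<^sub>v t - GF *\<^sub>v g"
    unfolding GF_def GT_def assoc_mult_mat_vec[OF L MK_carrier g]
      assoc_mult_mat[OF L R_carrier toep_Phi_carrier] assoc_mult_mat_vec[OF L RPhi t] ..
  also have "\<dots> = - lin t g"
    unfolding lin_def using GT_carrier GF_carrier
    by (intro eq_vecI) (auto simp del: index_mult_mat_vec)
  finally show ?thesis .
qed

lemma G_dim: "dim_col G = m + n - 1 + m"
  unfolding G_def append_cols_def
  using carrier_matD[OF Di(1)] carrier_matD[OF MK_carrier] by simp

lemma lin_index:
  assumes t: "t \<in> carrier_vec (m + n - 1)" and g: "g \<in> carrier_vec m" and i: "i < k"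
  shows "lin t g $ i = (\<Sum>j<m. GF $$ (i, j) * g $ j) - (\<Sum>p<m + n - 1. GT $$ (i, p) * t $ p)"
  using assms GT_carrier GF_carrier unfolding lin_def
  by (simp add: scalar_prod_def lessThan_atLeast0)

lemma k_pos: "0 < k"
  using Lz L by (intro Nat.gr0I) (auto simp: vec_eq_iff)

lemma Lz_carrier: "L *\<^sub>v z \<in> carrier_vec k"
  by (rule mult_mat_vec_carrier[OF L z_carrier])

lemma norm2_Lz_pos: "0 < norm2 (L *\<^sub>v z)"
proof -
  have "norm2 (L *\<^sub>v z) \<noteq> 0" using Lz L by (simp add: norm2_eq_0_iff)
  then show ?thesis using norm2_nonneg[of "L *\<^sub>v z"] by linarith
qed

lemma norm_inf_Lz_pos: "0 < norm_inf (L *\<^sub>v z)"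
proof -
  obtain i where i: "i < k" "(L *\<^sub>v z) $ i \<noteq> 0"
    using Lz Lz_carrier by (metis carrier_vecD dim_vec eq_vecI index_zero_vec(1) index_zero_vec(2))
  have "\<bar>(L *\<^sub>v z) $ i\<bar> \<le> norm_inf (L *\<^sub>v z)"
    unfolding norm_inf_def carrier_vecD[OF Lz_carrier] using i by (intro Max_ge) auto
  then show ?thesis using i by linarith
qed

lemma solution_change_carrier:
  "w \<in> solution_changes A B D f z P \<Longrightarrow> L *\<^sub>v w \<in> carrier_vec k"
  by (rule mult_mat_vec_carrier[OF L]) (use z_carrier in \<open>auto simp: solution_changes_def\<close>)

lemma normwise_limit:
  "(normwise_sup A B D f L z \<longlongrightarrow>
     ereal (spectral_norm G * frob_norm_pair B f / norm2 (L *\<^sub>v z))) (at_right 0)"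
proof -
  define c where "c = norm2 (L *\<^sub>v z)"
  define \<beta> where "\<beta> = frob_norm_pair B f"
  define d where "d = max (entry_sum Di * (real (m + n - 1) * \<beta>)) (real m * \<beta>)"
  have c: "0 < c" by (simp add: c_def norm2_Lz_pos)
  have \<beta>: "0 \<le> \<beta>" by (simp add: \<beta>_def frob_norm_pair_def)
  have adm_iff: "normwise_admissible B f \<eta> (toep_of_vec n m t) g \<longleftrightarrow>
      norm2 ((toep_D n m *\<^sub>v t) @\<^sub>v g) \<le> \<eta> * \<beta>" if "t \<in> carrier_vec (m + n - 1)" for \<eta> t g
    unfolding normwise_admissible_def \<beta>_def
    using frob_norm_pair_toep_of_vec[OF pos(2,1) that] by simp
  have dim_Dt: "dim_vec (toep_D n m *\<^sub>v t) = m + n - 1" for t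
    using toep_D_carrier[of n m] by simp
  have eq: "normwise_sup A B D f L z = (\<lambda>\<eta>. SUP w \<in> solution_changes A B D f z (normwise_admissible B f \<eta>).
      ereal (norm2 (L *\<^sub>v w) / c / \<eta>))"
    by (rule ext) (simp add: normwise_sup_def c_def mult.commute)
  show ?thesis
    unfolding eq \<beta>_def[symmetric] c_def[symmetric]
  proof (rule condition_limit[where C = "1 / c" and c = d])
    show "0 \<le> 1 / c" using c by simp
    show "norm2 (u + v) / c \<le> norm2 u / c + 1 / c * norm1 v"
      if "u \<in> carrier_vec k" "v \<in> carrier_vec k" for u v
      using norm2_add_le[OF that] c by (simp add: divide_right_mono flip: add_divide_distrib)
    show "norm2 (\<eta> \<cdot>\<^sub>v u) / c = \<eta> * (norm2 u / c)" if "0 < \<eta>" for \<eta> u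
      using that by (simp add: norm2_smult)
    show "normwise_admissible B f \<eta> (toep_of_vec n m (\<eta> \<cdot>\<^sub>v t)) (\<eta> \<cdot>\<^sub>v g) \<longleftrightarrow>
        normwise_admissible B f 1 (toep_of_vec n m t) g"
      if \<eta>: "0 < \<eta>" and t: "t \<in> carrier_vec (m + n - 1)" for \<eta> t g
    proof -
      have "(toep_D n m *\<^sub>v (\<eta> \<cdot>\<^sub>v t)) @\<^sub>v (\<eta> \<cdot>\<^sub>v g) = \<eta> \<cdot>\<^sub>v ((toep_D n m *\<^sub>v t) @\<^sub>v g)"
        unfolding mult_mat_vec[OF toep_D_carrier t]
        by (intro eq_vecI) (auto simp del: index_mult_mat_vec)
      then show ?thesis
        using \<eta> t by (simp add: adm_iff norm2_smult del: One_nat_def)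
    qed
    have Dt0: "(toep_D n m *\<^sub>v 0\<^sub>v (m + n - 1)) @\<^sub>v 0\<^sub>v m = 0\<^sub>v (m + n - 1 + m)"
      using toep_D_carrier[of n m] by (intro eq_vecI) auto
    show adm0: "normwise_admissible B f 1 (toep_of_vec n m (0\<^sub>v (m + n - 1))) (0\<^sub>v m)"
      by (subst adm_iff) (simp_all only: Dt0 zero_carrier_vec norm2_zero mult_1 \<beta>)
    fix t g assume t: "t \<in> carrier_vec (m + n - 1)" and g: "g \<in> carrier_vec m"
      and "normwise_admissible B f 1 (toep_of_vec n m t) g"
    then have le: "norm2 ((toep_D n m *\<^sub>v t) @\<^sub>v g) \<le> \<beta>" by (simp add: adm_iff)
    have Dt: "toep_D n m *\<^sub>v t \<in> carrier_vec (m + n - 1)" by (rule mult_mat_vec_carrier[OF toep_D_carrier t])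
    have sq: "(norm2 (toep_D n m *\<^sub>v t))\<^sup>2 + (norm2 g)\<^sup>2 \<le> \<beta>\<^sup>2"
      unfolding norm2_append[symmetric] by (rule power_mono[OF le]) simp
    have n1: "norm2 (toep_D n m *\<^sub>v t) \<le> \<beta>"
      by (rule power2_le_imp_le[OF _ \<beta>]) (use sq zero_le_power2[of "norm2 g"] in linarith)
    have n2: "norm2 g \<le> \<beta>"
      by (rule power2_le_imp_le[OF _ \<beta>]) (use sq zero_le_power2[of "norm2 (toep_D n m *\<^sub>v t)"] in linarith)
    have "t = Di *\<^sub>v (toep_D n m *\<^sub>v t)"
      unfolding assoc_mult_mat_vec[OF Di(1) toep_D_carrier t, symmetric] Di(3) using t by simp
    then have "norm1 t \<le> entry_sum Di * norm1 (toep_D n m *\<^sub>v t)"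
      using norm1_mult_le[of "toep_D n m *\<^sub>v t" Di] dim_Dt[of t] carrier_matD(2)[OF Di(1)] by simp
    also have "\<dots> \<le> entry_sum Di * (real (m + n - 1) * \<beta>)"
      using norm1_le_norm2[of "toep_D n m *\<^sub>v t"] mult_left_mono[OF n1, of "real (m + n - 1)"]
      unfolding dim_Dt by (intro mult_left_mono) auto
    finally have b1: "norm1 t \<le> d" by (simp add: d_def)
    have "norm1 g \<le> real m * \<beta>"
      using norm1_le_norm2[of g] mult_left_mono[OF n2, of "real m"] g by auto
    then show "norm1 t \<le> d \<and> norm1 g \<le> d" using b1 by (simp add: d_def)
    have "norm2 (lin t g) \<le> spectral_norm G * norm2 ((toep_D n m *\<^sub>v t) @\<^sub>v g)"
      using norm2_mult_le_spectral_norm[of "(toep_D n m *\<^sub>v t) @\<^sub>v g" G] append_carrier_vec[OF Dt g]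
      unfolding G_dim G_mult[OF t g] norm2_uminus by simp
    also have "\<dots> \<le> spectral_norm G * \<beta>"
    proof (rule mult_left_mono[OF le])
      have "G *\<^sub>v 0\<^sub>v (dim_col G) = 0\<^sub>v (dim_row G)" by (intro eq_vecI) auto
      then have "0 \<in> {norm2 (G *\<^sub>v v) |v. v \<in> carrier_vec (dim_col G) \<and> norm2 v \<le> 1}"
        by (auto intro!: exI[of _ "0\<^sub>v (dim_col G)"])
      then show "0 \<le> spectral_norm G"
        unfolding spectral_norm_def by (rule cSup_upper[OF _ spectral_norm_bdd])
    qed
    finally show "norm2 (lin t g) / c \<le> spectral_norm G * \<beta> / c"
      using c by (simp add: divide_right_mono)
  next
    fix \<tau> assume le: "\<And>t g. t \<in> carrier_vec (m + n - 1) \<Longrightarrow> g \<in> carrier_vec m \<Longrightarrow>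
      normwise_admissible B f 1 (toep_of_vec n m t) g \<Longrightarrow> norm2 (lin t g) / c \<le> \<tau>"
    \<comment> \<open>Every vector of norm at most \<open>\<beta>\<close> is of the form \<open>(toep_D t, g)\<close> with \<open>(t, g)\<close> admissible.\<close>
    have val: "\<beta> * norm2 (G *\<^sub>v v) \<le> \<tau> * c" if v: "v \<in> carrier_vec (dim_col G)" and nv: "norm2 v \<le> 1" for v
    proof -
      define u where "u = \<beta> \<cdot>\<^sub>v v"
      define a where "a = vec_first u (m + n - 1)"
      define g where "g = vec_last u m"
      define t where "t = Di *\<^sub>v a"
      have u: "u \<in> carrier_vec (m + n - 1 + m)" using v by (simp add: u_def G_dim)
      have a: "a \<in> carrier_vec (m + n - 1)" and g: "g \<in> carrier_vec m"
        by (simp_all add: a_def g_def)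
      have uag: "a @\<^sub>v g = u" unfolding a_def g_def by (rule vec_first_last_append[OF u])
      have t: "t \<in> carrier_vec (m + n - 1)" unfolding t_def by (rule mult_mat_vec_carrier[OF Di(1) a])
      have Dt: "toep_D n m *\<^sub>v t = a"
        unfolding t_def assoc_mult_mat_vec[OF toep_D_carrier Di(1) a, symmetric] Di(2) using a by simp
      have "norm2 u \<le> \<beta>" using \<beta> mult_left_mono[OF nv \<beta>] by (simp add: u_def norm2_smult)
      then have "normwise_admissible B f 1 (toep_of_vec n m t) g"
        using t by (simp add: adm_iff Dt uag)
      from le[OF t g this] have "norm2 (lin t g) \<le> \<tau> * c" using c by (simp add: field_simps)
      moreover have "norm2 (lin t g) = norm2 (G *\<^sub>v u)"
        using G_mult[OF t g] unfolding Dt uag by (simp add: norm2_uminus)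
      moreover have "G *\<^sub>v u = \<beta> \<cdot>\<^sub>v (G *\<^sub>v v)"
        unfolding u_def by (rule mult_mat_vec[OF _ v, of G "dim_row G"]) auto
      ultimately show ?thesis using \<beta> by (simp add: norm2_smult)
    qed
    show "spectral_norm G * \<beta> / c \<le> \<tau>"
    proof (cases "\<beta> = 0")
      case True
      then show ?thesis using val[of "0\<^sub>v (dim_col G)"] c by (simp add: zero_le_mult_iff)
    next
      case False
      then have \<beta>0: "0 < \<beta>" using \<beta> by simp
      have "spectral_norm G \<le> \<tau> * c / \<beta>"
        unfolding spectral_norm_def
      proof (rule cSup_least)
        have "norm2 (0\<^sub>v (dim_col G)) \<le> 1" by simp
        then show "{norm2 (G *\<^sub>v v) |v. v \<in> carrier_vec (dim_col G) \<and> norm2 v \<le> 1} \<noteq> {}"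
          by (metis (mono_tags, lifting) empty_iff mem_Collect_eq zero_carrier_vec)
      qed (use val \<beta>0 in \<open>auto simp: field_simps\<close>)
      then show ?thesis using \<beta>0 c by (simp add: field_simps)
    qed
  qed
qed

text \<open>The entrywise maximum of the absolute value of the linear part over the box of entrywise
  admissible perturbations with \<open>\<eta> = 1\<close>.\<close>

definition bound_vec :: "real vec" where
  "bound_vec = abs_mat GT *\<^sub>v vec_toep (abs_mat B) + abs_mat GF *\<^sub>v abs_vec f"

lemma bound_vec_carrier: "bound_vec \<in> carrier_vec k"
  unfolding bound_vec_def using GF_carrier by (intro carrier_vecI) simp

lemma vec_toep_abs_B: "vec_toep (abs_mat B) = abs_vec (vec_toep B)"
  by (rule vec_toep_abs) (use pos B_carrier in auto)

lemma vec_toep_B: "vec_toep B \<in> carrier_vec (m + n - 1)"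
  by (rule vec_toep_carrier[OF B_carrier])

lemma bound_vec_index:
  assumes "i < k"
  shows "bound_vec $ i = (\<Sum>p<m + n - 1. \<bar>GT $$ (i, p)\<bar> * \<bar>vec_toep B $ p\<bar>) +
    (\<Sum>j<m. \<bar>GF $$ (i, j)\<bar> * \<bar>f $ j\<bar>)"
  using assms GT_carrier GF_carrier f vec_toep_B unfolding bound_vec_def vec_toep_abs_B
  by (simp add: scalar_prod_def lessThan_atLeast0)

lemma bound_vec_nonneg: "i < k \<Longrightarrow> 0 \<le> bound_vec $ i"
  by (simp add: bound_vec_index sum_nonneg)

lemma entrywise_admissible_iff:
  assumes t: "t \<in> carrier_vec (m + n - 1)" and g: "g \<in> carrier_vec m"
  shows "entrywise_admissible B f \<eta> (toep_of_vec n m t) g \<longleftrightarrow>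
    (\<forall>p<m + n - 1. \<bar>t $ p\<bar> \<le> \<eta> * \<bar>vec_toep B $ p\<bar>) \<and> (\<forall>j<m. \<bar>g $ j\<bar> \<le> \<eta> * \<bar>f $ j\<bar>)"
proof -
  have Bt: "toep_of_vec n m (vec_toep B) = B" by (rule toep_of_vec_vec_toep[OF pos(2,1) B])
  have idx: "B $$ (r, s) = vec_toep B $ (s + (n - 1) - r)" if "r < n" "s < m" for r s
    using toep_of_vec_index[OF that, of "vec_toep B"] unfolding Bt .
  have "abs_mat (toep_of_vec n m t) \<le> \<eta> \<cdot>\<^sub>m abs_mat B \<longleftrightarrow>
      (\<forall>r<n. \<forall>s<m. \<bar>t $ (s + (n - 1) - r)\<bar> \<le> \<eta> * \<bar>vec_toep B $ (s + (n - 1) - r)\<bar>)"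
    using B_carrier by (auto simp: less_eq_mat_def toep_of_vec_index idx)
  also have "\<dots> \<longleftrightarrow> (\<forall>p<m + n - 1. \<bar>t $ p\<bar> \<le> \<eta> * \<bar>vec_toep B $ p\<bar>)" (is "?l \<longleftrightarrow> ?r")
  proof
    assume l: ?l
    show ?r
    proof (intro allI impI)
      fix p assume p: "p < m + n - 1"
      show "\<bar>t $ p\<bar> \<le> \<eta> * \<bar>vec_toep B $ p\<bar>"
      proof (cases "p < n - 1")
        case True
        then have "n - 1 - p < n" "0 + (n - 1) - (n - 1 - p) = p" using p by auto
        with l pos show ?thesis by metis
      next
        case False
        then have "p - (n - 1) < m" "p - (n - 1) + (n - 1) - 0 = p" using p pos by auto
        with l pos show ?thesis by metis
      qed
    qed
  next
    assume r: ?r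
    show ?l
    proof (intro allI impI)
      fix i s assume "i < n" "s < m"
      then have "s + (n - 1) - i < m + n - 1" by auto
      then show "\<bar>t $ (s + (n - 1) - i)\<bar> \<le> \<eta> * \<bar>vec_toep B $ (s + (n - 1) - i)\<bar>" using r by blast
    qed
  qed
  finally show ?thesis
    using f g by (auto simp: entrywise_admissible_def less_eq_vec_def)
qed

lemma entrywise_limit:
  assumes w: "\<And>i. i < k \<Longrightarrow> 0 < w i"
  shows "((\<lambda>\<eta>. SUP v \<in> solution_changes A B D f z (entrywise_admissible B f \<eta>).
      ereal (wmax k w (L *\<^sub>v v) / \<eta>)) \<longlongrightarrow> ereal (wmax k w bound_vec)) (at_right 0)"
proof (rule condition_limit[where C = "\<Sum>i<k. 1 / w i" and c = "max (norm1 (vec_toep B)) (norm1 f)"])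
  show "0 \<le> (\<Sum>i<k. 1 / w i)" using w by (intro sum_nonneg) (auto simp: less_imp_le)
  show "wmax k w (u + v) \<le> wmax k w u + (\<Sum>i<k. 1 / w i) * norm1 v"
    if "u \<in> carrier_vec k" "v \<in> carrier_vec k" for u v
    by (rule wmax_add_le[OF k_pos w that])
  show "wmax k w (\<eta> \<cdot>\<^sub>v u) = \<eta> * wmax k w u" if "0 < \<eta>" "u \<in> carrier_vec k" for \<eta> u
    by (rule wmax_smult[OF k_pos that])
  show "entrywise_admissible B f \<eta> (toep_of_vec n m (\<eta> \<cdot>\<^sub>v t)) (\<eta> \<cdot>\<^sub>v g) \<longleftrightarrow>
      entrywise_admissible B f 1 (toep_of_vec n m t) g"
    if "0 < \<eta>" and t: "t \<in> carrier_vec (m + n - 1)" and g: "g \<in> carrier_vec m" for \<eta> t g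
  proof -
    have "\<eta> \<cdot>\<^sub>v t \<in> carrier_vec (m + n - 1)" "\<eta> \<cdot>\<^sub>v g \<in> carrier_vec m" using t g by auto
    from entrywise_admissible_iff[OF this] show ?thesis
      unfolding entrywise_admissible_iff[OF t g] using that by (simp add: abs_mult)
  qed
  show "entrywise_admissible B f 1 (toep_of_vec n m (0\<^sub>v (m + n - 1))) (0\<^sub>v m)"
    by (subst entrywise_admissible_iff) auto
  fix t g assume t: "t \<in> carrier_vec (m + n - 1)" and g: "g \<in> carrier_vec m"
    and "entrywise_admissible B f 1 (toep_of_vec n m t) g"
  then have tb: "\<And>p. p < m + n - 1 \<Longrightarrow> \<bar>t $ p\<bar> \<le> \<bar>vec_toep B $ p\<bar>"
    and gf: "\<And>j. j < m \<Longrightarrow> \<bar>g $ j\<bar> \<le> \<bar>f $ j\<bar>"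
    by (simp_all add: entrywise_admissible_iff)
  have "norm1 t \<le> norm1 (vec_toep B)"
    using t vec_toep_B tb unfolding norm1_def by (auto intro!: sum_mono)
  moreover have "norm1 g \<le> norm1 f"
    using g f gf unfolding norm1_def by (auto intro!: sum_mono)
  ultimately show "norm1 t \<le> max (norm1 (vec_toep B)) (norm1 f) \<and>
      norm1 g \<le> max (norm1 (vec_toep B)) (norm1 f)" by auto
  have le: "\<bar>lin t g $ i\<bar> \<le> bound_vec $ i" if i: "i < k" for i
  proof -
    have "\<bar>lin t g $ i\<bar> \<le> \<bar>\<Sum>j<m. GF $$ (i, j) * g $ j\<bar> + \<bar>\<Sum>p<m + n - 1. GT $$ (i, p) * t $ p\<bar>"
      unfolding lin_index[OF t g i] by (rule abs_triangle_ineq4)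
    also have "\<bar>\<Sum>j<m. GF $$ (i, j) * g $ j\<bar> \<le> (\<Sum>j<m. \<bar>GF $$ (i, j)\<bar> * \<bar>f $ j\<bar>)"
      by (rule order_trans[OF sum_abs sum_mono]) (auto simp: abs_mult gf mult_left_mono)
    also have "\<bar>\<Sum>p<m + n - 1. GT $$ (i, p) * t $ p\<bar> \<le>
        (\<Sum>p<m + n - 1. \<bar>GT $$ (i, p)\<bar> * \<bar>vec_toep B $ p\<bar>)"
      by (rule order_trans[OF sum_abs sum_mono]) (auto simp: abs_mult tb mult_left_mono)
    finally show ?thesis unfolding bound_vec_index[OF i] by simp
  qed
  show "wmax k w (lin t g) \<le> wmax k w bound_vec"
    unfolding wmax_le_iff[OF k_pos]
  proof (intro allI impI)
    fix i assume i: "i < k"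
    have "\<bar>lin t g $ i\<bar> / w i \<le> \<bar>bound_vec $ i\<bar> / w i"
      using le[OF i] bound_vec_nonneg[OF i] w[OF i] by (simp add: divide_right_mono)
    also have "\<dots> \<le> wmax k w bound_vec" by (rule wmax_ge[OF i])
    finally show "\<bar>lin t g $ i\<bar> / w i \<le> wmax k w bound_vec" .
  qed
next
  fix \<tau> assume le: "\<And>t g. t \<in> carrier_vec (m + n - 1) \<Longrightarrow> g \<in> carrier_vec m \<Longrightarrow>
    entrywise_admissible B f 1 (toep_of_vec n m t) g \<Longrightarrow> wmax k w (lin t g) \<le> \<tau>"
  show "wmax k w bound_vec \<le> \<tau>"
    unfolding wmax_le_iff[OF k_pos]
  proof (intro allI impI)
    fix i assume i: "i < k"
    \<comment> \<open>A point of the box at which entry \<open>i\<close> of the linear part is largest.\<close>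
    define t where "t = vec (m + n - 1) (\<lambda>p. - sgn (GT $$ (i, p)) * \<bar>vec_toep B $ p\<bar>)"
    define g where "g = vec m (\<lambda>j. sgn (GF $$ (i, j)) * \<bar>f $ j\<bar>)"
    have t: "t \<in> carrier_vec (m + n - 1)" and g: "g \<in> carrier_vec m" by (simp_all add: t_def g_def)
    have "entrywise_admissible B f 1 (toep_of_vec n m t) g"
      unfolding entrywise_admissible_iff[OF t g]
      by (auto simp: t_def g_def abs_mult abs_sgn_eq)
    from le[OF t g this] have "\<bar>lin t g $ i\<bar> / w i \<le> \<tau>"
      using i unfolding wmax_le_iff[OF k_pos] by blast
    moreover have "lin t g $ i = bound_vec $ i"
    proof -
      have sgn: "a * (sgn a * b) = \<bar>a\<bar> * b" for a b :: real
        by (simp add: abs_sgn mult.assoc)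
      show ?thesis
        unfolding lin_index[OF t g i] bound_vec_index[OF i]
        by (simp add: t_def g_def sgn sum_negf)
    qed
    ultimately show "\<bar>bound_vec $ i\<bar> / w i \<le> \<tau>" by simp
  qed
qed

lemma mixed_limit:
  "(mixed_sup A B D f L z \<longlongrightarrow> ereal (norm_inf bound_vec / norm_inf (L *\<^sub>v z))) (at_right 0)"
proof -
  define c where "c = norm_inf (L *\<^sub>v z)"
  have c: "0 < c" by (simp add: c_def norm_inf_Lz_pos)
  have "mixed_sup A B D f L z = (\<lambda>\<eta>. SUP v \<in> solution_changes A B D f z (entrywise_admissible B f \<eta>).
      ereal (wmax k (\<lambda>_. c) (L *\<^sub>v v) / \<eta>))"
    by (rule ext)
      (simp add: mixed_sup_def wmax_const[OF k_pos c] solution_change_carrier c_def[symmetric]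
        mult.commute cong: SUP_cong)
  then show ?thesis
    using entrywise_limit[of "\<lambda>_. c"] c
    by (simp add: wmax_const[OF k_pos c bound_vec_carrier] flip: c_def)
qed

lemma componentwise_limit:
  assumes nz: "\<And>i. i < k \<Longrightarrow> (L *\<^sub>v z) $ i \<noteq> 0"
  shows "(componentwise_sup A B D f L z \<longlongrightarrow> ereal (norm_inf
    (moore_penrose (diag_of_vec (L *\<^sub>v z)) * abs_mat GT *\<^sub>v vec_toep (abs_mat B)
     + moore_penrose (diag_of_vec (L *\<^sub>v z)) * abs_mat GF *\<^sub>v abs_vec f))) (at_right 0)"
proof -
  let ?w = "\<lambda>i. \<bar>(L *\<^sub>v z) $ i\<bar>"
  let ?X = "mat_diag k (\<lambda>i. 1 / (L *\<^sub>v z) $ i)"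
  have dim: "dim_vec (L *\<^sub>v z) = k" using Lz_carrier by (rule carrier_vecD)
  have "ereal (1 / \<eta>) * norm_inf (quot_vec u (L *\<^sub>v z)) = ereal (wmax k ?w u / \<eta>)" for \<eta> u
    using norm_inf_quot_vec[OF k_pos Lz_carrier nz, of u] by simp
  then have eq: "componentwise_sup A B D f L z =
      (\<lambda>\<eta>. SUP v \<in> solution_changes A B D f z (entrywise_admissible B f \<eta>).
        ereal (wmax k ?w (L *\<^sub>v v) / \<eta>))"
    by (intro ext) (simp add: componentwise_sup_def)
  have mp: "moore_penrose (diag_of_vec (L *\<^sub>v z)) = ?X"
    using moore_penrose_diag[of "L *\<^sub>v z"] nz unfolding dim by blast
  have aT: "abs_mat GT \<in> carrier_mat k (m + n - 1)" and aF: "abs_mat GF \<in> carrier_mat k m"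
    using GT_carrier GF_carrier by auto
  have bT: "vec_toep (abs_mat B) \<in> carrier_vec (m + n - 1)"
    unfolding vec_toep_abs_B using vec_toep_B by simp
  have bF: "abs_vec f \<in> carrier_vec m" using f by simp
  have "?X * abs_mat GT *\<^sub>v vec_toep (abs_mat B) + ?X * abs_mat GF *\<^sub>v abs_vec f = ?X *\<^sub>v bound_vec"
    unfolding bound_vec_def assoc_mult_mat_vec[OF mat_diag_dim aT bT] assoc_mult_mat_vec[OF mat_diag_dim aF bF]
    by (rule mult_add_distrib_mat_vec[symmetric, OF mat_diag_dim])
      (rule mult_mat_vec_carrier[OF aT bT] mult_mat_vec_carrier[OF aF bF])+
  moreover have "norm_inf (?X *\<^sub>v bound_vec) = wmax k ?w bound_vec"
  proof -
    have "(?X *\<^sub>v bound_vec) $ i = bound_vec $ i / (L *\<^sub>v z) $ i" if "i < k" for i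
      using that bound_vec_carrier unfolding mat_diag_def
      by (simp add: scalar_prod_def if_distrib[of "\<lambda>c. c * _"] cong: if_cong)
    moreover have "dim_vec (?X *\<^sub>v bound_vec) = k" by (simp add: mat_diag_def)
    ultimately show ?thesis
      unfolding norm_inf_def wmax_def by (intro arg_cong[of _ _ Max] image_cong) auto
  qed
  ultimately show ?thesis
    unfolding eq mp using entrywise_limit[of ?w] nz by simp
qed

end

theorem theorem5p2:
  fixes A B D L S M N K R :: "real mat" and f x y z :: "real vec" and m n k :: nat
  assumes pos: "0 < m" "0 < n"
    and A: "A \<in> carrier_mat m m" "invertible_mat A"
    and B: "B \<in> toeplitz_mats n m"
    and D: "D \<in> carrier_mat n n"
    and f: "f \<in> carrier_vec m"
    and x: "x \<in> carrier_vec m"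
    and y: "y \<in> carrier_vec n"
    and L: "L \<in> carrier_mat k (m + n)"
    and nonsing: "invertible_mat (saddle_mat A B D)"
    and z_def: "z = x @\<^sub>v y"
    and sol: "saddle_mat A B D *\<^sub>v z = f @\<^sub>v 0\<^sub>v n"
    and S_def: "S = D - B * mat_inv A * B\<^sup>T"
    and M_def: "M = mat_inv A + mat_inv A * B\<^sup>T * mat_inv S * B * mat_inv A"
    and N_def: "N = - (mat_inv A * B\<^sup>T * mat_inv S)"
    and K_def: "K = - (mat_inv S * B * mat_inv A)"
    and R_def: "R = (M \<otimes>\<^sub>K row_mat y + row_mat x \<otimes>\<^sub>K N) @\<^sub>r
                    (K \<otimes>\<^sub>K row_mat y + row_mat x \<otimes>\<^sub>K mat_inv S)"
    and Lz: "L *\<^sub>v z \<noteq> 0\<^sub>v k"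
  shows "(normwise_sup A B D f L z \<longlongrightarrow> normwise_cond A B D f L z) (at_right 0) \<and>
         normwise_cond A B D f L z =
           ereal (spectral_norm (L * ((R * toep_Phi n m * mat_inv (toep_D n m)) @\<^sub>c (- (M @\<^sub>r K))))
                  * frob_norm_pair B f / norm2 (L *\<^sub>v z)) \<and>
         (mixed_sup A B D f L z \<longlongrightarrow> mixed_cond A B D f L z) (at_right 0) \<and>
         mixed_cond A B D f L z =
           ereal (norm_inf (abs_mat (L * R * toep_Phi n m) *\<^sub>v vec_toep (abs_mat B)
                            + abs_mat (L * (M @\<^sub>r K)) *\<^sub>v abs_vec f)
                  / norm_inf (L *\<^sub>v z)) \<and>
         ((\<forall>i<k. (L *\<^sub>v z) $ i \<noteq> 0) \<longrightarrow>
           (componentwise_sup A B D f L z \<longlongrightarrow> componentwise_cond A B D f L z) (at_right 0) \<and>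
           componentwise_cond A B D f L z =
             ereal (norm_inf (moore_penrose (diag_of_vec (L *\<^sub>v z)) *
                                abs_mat (L * R * toep_Phi n m) *\<^sub>v vec_toep (abs_mat B)
                              + moore_penrose (diag_of_vec (L *\<^sub>v z)) *
                                abs_mat (L * (M @\<^sub>r K)) *\<^sub>v abs_vec f)))"
proof -
  interpret saddle_problem A B D L S M N K R f x y z m n k
    by unfold_locales (fact assms)+
  have Lim: "(h \<longlongrightarrow> Lim (at_right 0) h) (at_right 0) \<and> Lim (at_right 0) h = l"
    if "(h \<longlongrightarrow> l) (at_right 0)" for h :: "real \<Rightarrow> ereal" and l
    using that tendsto_Lim[OF trivial_limit_at_right_real that] by simp
  show ?thesis
    using Lim[OF normwise_limit] Lim[OF mixed_limit] Lim[OF componentwise_limit]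
    unfolding normwise_cond_def mixed_cond_def componentwise_cond_def
      G_def GT_def GF_def bound_vec_def
    by blast
qed

end
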